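(* Assuming $\exists^2$, a Cantor realiser is Kleene-computable from any functional performing any one of the following tasks: (1) for $f:[0,1]\rightarrow\mathbb{Q}$ of bounded variation, find $x,y\in[0,1]$ with $x\neq y$ and $f(x)=f(y)$; (2) for $f:[0,1]\rightarrow\mathbb{R}$ of bounded variation, find a point of continuity of $f$ in $[0,1]$; (3) for $f:[0,1]\rightarrow[0,1]$ which is Riemann integrable (or has bounded variation) with $\int_0^1f(x)\,dx=0$, find $y\in[0,1]$ with $f(y)=0$; (4) for $f,g:\mathbb{R}\rightarrow\mathbb{R}$ such that $f,g$ have bounded variation on $[0,a]$ for every $a>0$ and such that $\mathfrak{L}(f)$ and $\mathfrak{L}(g)$ exist and are equal on $[0,+\infty)$, find $x\in(0,\infty)$ with $f(x)=g(x)$. Moreover, any NIN-realiser computes a functional performing task (1). Finally, assuming $\exists^2$, a weak Cantor realiser is Kleene-computable from any functional performing any one of the tasks (1)–(4) in which "bounded variation" is replaced by "has a variation".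
   Context: Computability is Kleene's higher-order computability via S1–S9; metatheory ZFC. Sets are given by characteristic functions. Kleene's $\exists^2$ is $\varphi:\mathbb{N}^{\mathbb{N}}\rightarrow\{0,1\}$ with $\varphi(f)=0\leftrightarrow(\exists n)(f(n)=0)$. A function $f:[a,b]\rightarrow\mathbb{R}$ has bounded variation if there is $k_0\in\mathbb{N}$ with $k_0\geq\sum_i|f(x_i)-f(x_{i+1})|$ for every partition $a=x_0<\dots<x_n=b$; it has a variation if the supremum $V_a^b(f)=\sup_{a\leq x_0<\dots<x_n\leq b}\sum_i|f(x_i)-f(x_{i+1})|$ exists and is finite. The Laplace transform is $\mathfrak{L}(f)(s)=\int_0^{+\infty}e^{-st}f(t)\,dt$, interpreted as the limit of Riemann integrals $\int_0^N$ as $N\to\infty$, if it exists. $Y:[0,1]\rightarrow\mathbb{N}$ is injective on $A$ if $(\forall x,y\in A)(Y(x)=Y(y)\rightarrow x=y)$, and bijective on $A$ if moreover $(\forall n)(\exists x\in A)(Y(x)=n)$. A Cantor realiser takes as input $A\subseteq[0,1]$ and $Y:[0,1]\rightarrow\mathbb{N}$ injective on $A$ and outputs some $x\in[0,1]\setminus A$; a weak Cantor realiser does the same for inputs with $Y$ bijective on $A$. A NIN-realiser takes as input any $Y:[0,1]\rightarrow\mathbb{N}$ and outputs $x,y\in[0,1]$ with $x\neq y$ and $Y(x)=Y(y)$. *)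

theory Defs
  imports "HOL-Analysis.Analysis" "HOL-Library.Nat_Bijection" "HOL-Library.Lub_Glb"
begin

section \<open>Kleene computability via S1--S9\<close>

text \<open>
  Objects of finite type up to level three over the full set-theoretic hierarchy. Every finite type
  is of the form \<open>\<sigma>\<^sub>1 \<rightarrow> \<dots> \<rightarrow> \<sigma>\<^sub>k \<rightarrow> 0\<close>. Below level three the types \<open>0\<close>, \<open>1\<close>, \<open>2\<close> and \<open>1 \<rightarrow> 1\<close> are
  used. A functional of level three is partial and takes a list of arguments whose types are
  prescribed by its signature; functionals with values of type \<open>1\<close> are uncurried.
\<close>

datatype ty = Ty0 | Ty1 | Ty2 | Ty11

datatype low =
    Num nat
  | Fun "nat \<Rightarrow> nat"
  | Fnl "(nat \<Rightarrow> nat) \<Rightarrow> nat"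
  | Op "(nat \<Rightarrow> nat) \<Rightarrow> nat \<Rightarrow> nat"

fun ty_of :: "low \<Rightarrow> ty" where
  "ty_of (Num n) = Ty0"
| "ty_of (Fun f) = Ty1"
| "ty_of (Fnl F) = Ty2"
| "ty_of (Op F) = Ty11"

type_synonym functional3 = "low list \<Rightarrow> nat option"

datatype obj = Low low | Fnl3 "ty list" functional3

fun obj_app :: "obj \<Rightarrow> low list \<Rightarrow> nat option" where
  "obj_app (Low (Fnl F)) [Fun f] = Some (F f)"
| "obj_app (Low (Op F)) [Fun f, Num n] = Some (F f n)"
| "obj_app (Fnl3 \<sigma> F) xs = (if map ty_of xs = \<sigma> then F xs else None)"
| "obj_app _ _ = None"

text \<open>
  \<open>kleene e args m\<close> is \<open>{e}(args) \<simeq> m\<close>; \<open>denotes d args x\<close> says that \<open>x\<close> is the (total)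
  object \<open>\<lambda>\<xi>. {d}(\<xi>, args)\<close>. As usual, S8 requires the argument objects to be total and, for a
  partial functional, to lie in its domain. S8 is stated for arbitrary signatures; for
  pure types it is \<open>{e}(\<Phi>, args) \<simeq> \<Phi>(\<lambda>\<xi>. {d}(\<xi>, \<Phi>, args))\<close>.
\<close>

inductive kleene :: "nat \<Rightarrow> obj list \<Rightarrow> nat \<Rightarrow> bool"
  and denotes :: "nat \<Rightarrow> obj list \<Rightarrow> low \<Rightarrow> bool"
where
  S1: "kleene (list_encode [1]) (Low (Num n) # args) (Suc n)"
| S2: "kleene (list_encode [2, q]) args q"
| S3: "kleene (list_encode [3]) (Low (Num n) # args) n"
| S4: "\<lbrakk>kleene e2 args k; kleene e1 (Low (Num k) # args) m\<rbrakk>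
        \<Longrightarrow> kleene (list_encode [4, e1, e2]) args m"
| S5_0: "kleene e1 args m \<Longrightarrow> kleene (list_encode [5, e1, e2]) (Low (Num 0) # args) m"
| S5_Suc: "\<lbrakk>kleene (list_encode [5, e1, e2]) (Low (Num n) # args) k;
            kleene e2 (Low (Num n) # Low (Num k) # args) m\<rbrakk>
        \<Longrightarrow> kleene (list_encode [5, e1, e2]) (Low (Num (Suc n)) # args) m"
| S6: "\<lbrakk>distinct p; set p = {..<length args}; kleene e1 (map ((!) args) p) m\<rbrakk>
        \<Longrightarrow> kleene (list_encode [6, list_encode p, e1]) args m"
| S7: "kleene (list_encode [7]) (Low (Fun f) # Low (Num n) # args) (f n)"
| S8: "\<lbrakk>list_all2 (\<lambda>d x. denotes d (\<Phi> # args) x) ds xs; obj_app \<Phi> xs = Some m\<rbrakk>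
        \<Longrightarrow> kleene (list_encode (8 # ds)) (\<Phi> # args) m"
| S9: "kleene d args m
        \<Longrightarrow> kleene (list_encode [9, length args]) (Low (Num d) # args @ args') m"
| den0: "kleene d args n \<Longrightarrow> denotes d args (Num n)"
| den1: "(\<And>n. kleene d (Low (Num n) # args) (f n)) \<Longrightarrow> denotes d args (Fun f)"
| den2: "(\<And>f. kleene d (Low (Fun f) # args) (F f)) \<Longrightarrow> denotes d args (Fnl F)"
| den11: "(\<And>f n. kleene d (Low (Fun f) # Low (Num n) # args) (F f n)) \<Longrightarrow> denotes d args (Op F)"

lemma list_encode_inject: "list_encode xs = list_encode ys \<longleftrightarrow> xs = ys"
  using inj_list_encode[of UNIV] by (auto dest: injD)

lemma obj_app_types:
  "obj_app \<Phi> xs = Some m \<Longrightarrow> obj_app \<Phi> ys = Some m' \<Longrightarrow> map ty_of xs = map ty_of ys"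
  by (cases "(\<Phi>, xs)" rule: obj_app.cases; cases "(\<Phi>, ys)" rule: obj_app.cases)
     (auto split: if_splits)

inductive_cases denotes_NumE: "denotes d args (Num n)"
inductive_cases denotes_FunE: "denotes d args (Fun f)"
inductive_cases denotes_FnlE: "denotes d args (Fnl F)"
inductive_cases denotes_OpE: "denotes d args (Op F)"

lemma ty_of_eq:
  "ty_of y = Ty0 \<Longrightarrow> \<exists>n. y = Num n"
  "ty_of y = Ty1 \<Longrightarrow> \<exists>f. y = Fun f"
  "ty_of y = Ty2 \<Longrightarrow> \<exists>F. y = Fnl F"
  "ty_of y = Ty11 \<Longrightarrow> \<exists>G. y = Op G"
  by (cases y; simp)+

lemma kleene_inversion:
  "kleene (list_encode [1]) (Low (Num n) # args) m \<Longrightarrow> m = Suc n"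
  "kleene (list_encode [2, q]) args m \<Longrightarrow> m = q"
  "kleene (list_encode [3]) (Low (Num n) # args) m \<Longrightarrow> m = n"
  "kleene (list_encode [4, e1, e2]) args m \<Longrightarrow> \<exists>k. kleene e2 args k \<and> kleene e1 (Low (Num k) # args) m"
  "kleene (list_encode [5, e1, e2]) (Low (Num 0) # args) m \<Longrightarrow> kleene e1 args m"
  "kleene (list_encode [5, e1, e2]) (Low (Num (Suc n)) # args) m \<Longrightarrow>
     \<exists>k. kleene (list_encode [5, e1, e2]) (Low (Num n) # args) k \<and>
         kleene e2 (Low (Num n) # Low (Num k) # args) m"
  "kleene (list_encode [6, list_encode p, e1]) args m \<Longrightarrow> kleene e1 (map ((!) args) p) m"
  "kleene (list_encode [7]) (Low (Fun f) # Low (Num n) # args) m \<Longrightarrow> m = f n"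
  "kleene (list_encode (8 # ds)) (\<Phi> # args) m \<Longrightarrow>
     \<exists>xs. list_all2 (\<lambda>d x. denotes d (\<Phi> # args) x) ds xs \<and> obj_app \<Phi> xs = Some m"
  "kleene (list_encode [9, length args]) (Low (Num d) # args @ args') m \<Longrightarrow> kleene d args m"
  by (erule kleene.cases; auto simp: list_encode_inject simp del: list_encode.simps)+

lemma kleene_deterministic:
  "kleene e args m \<Longrightarrow> (\<And>m'. kleene e args m' \<Longrightarrow> m' = m)"
  "denotes d args x \<Longrightarrow> (\<And>y. denotes d args y \<Longrightarrow> ty_of y = ty_of x \<Longrightarrow> y = x)"
proof (induction rule: kleene_denotes.inducts)
  case (S1 n args) then show ?case by (rule kleene_inversion(1))
next
  case (S2 q args) then show ?case by (rule kleene_inversion(2))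
next
  case (S3 n args) then show ?case by (rule kleene_inversion(3))
next
  case (S4 e2 args k e1 m) then show ?case using kleene_inversion(4) by blast
next
  case (S5_0 e1 args m e2) then show ?case using kleene_inversion(5) by blast
next
  case (S5_Suc e1 e2 n args k m) then show ?case using kleene_inversion(6) by blast
next
  case (S6 p args e1 m) then show ?case using kleene_inversion(7) by blast
next
  case (S7 f n args) then show ?case by (rule kleene_inversion(8))
next
  case (S8 \<Phi> args ds xs m)
  obtain ys where ys: "list_all2 (\<lambda>d x. denotes d (\<Phi> # args) x) ds ys"
    and m': "obj_app \<Phi> ys = Some m'"
    using kleene_inversion(9)[OF S8(3)] by blast
  have "map ty_of ys = map ty_of xs" using obj_app_types[OF m' S8(2)] .
  then have "ty_of (ys ! i) = ty_of (xs ! i)" if "i < length xs" for i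
    using that by (metis length_map nth_map)
  moreover have len: "length ys = length xs" using ys S8(1) by (simp add: list_all2_conv_all_nth)
  ultimately have "ys ! i = xs ! i" if "i < length xs" for i
    using S8(1) ys that unfolding list_all2_conv_all_nth by metis
  with len have "ys = xs" by (simp add: list_eq_iff_nth_eq)
  then show ?case using m' S8(2) by simp
next
  case (S9 d args m args') then show ?case using kleene_inversion(10) by blast
next
  case (den0 d args n)
  from den0.prems(2) obtain k where "y = Num k" using ty_of_eq(1) by auto
  with den0 show ?case by (blast elim: denotes_NumE)
next
  case (den1 d args f)
  from den1.prems(2) obtain g where g: "y = Fun g" using ty_of_eq(2) by auto
  then have "\<And>n. kleene d (Low (Num n) # args) (g n)" using den1.prems(1) by (blast elim: denotes_FunE)
  then have "g n = f n" for n by (rule den1.IH)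
  with g show ?case by blast
next
  case (den2 d args F)
  from den2.prems(2) obtain G where G: "y = Fnl G" using ty_of_eq(3) by auto
  then have "\<And>f. kleene d (Low (Fun f) # args) (G f)" using den2.prems(1) by (blast elim: denotes_FnlE)
  then have "G f = F f" for f by (rule den2.IH)
  with G show ?case by blast
next
  case (den11 d args F)
  from den11.prems(2) obtain G where G: "y = Op G" using ty_of_eq(4) by auto
  then have "\<And>f n. kleene d (Low (Fun f) # Low (Num n) # args) (G f n)"
    using den11.prems(1) by (blast elim: denotes_OpE)
  then have "G f n = F f n" for f n by (rule den11.IH)
  with G show ?case by blast
qed

definition kleene_computable_from :: "ty list \<Rightarrow> functional3 \<Rightarrow> obj list \<Rightarrow> bool" where
  "kleene_computable_from \<sigma> C oracles \<longleftrightarrow>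
     (\<exists>e. \<forall>xs. map ty_of xs = \<sigma> \<longrightarrow>
        (\<forall>m. kleene e (map Low xs @ oracles) m \<longleftrightarrow> C xs = Some m))"

definition exists2 :: "(nat \<Rightarrow> nat) \<Rightarrow> nat" where
  "exists2 f = (if \<exists>n. f n = 0 then 0 else 1)"

section \<open>Representations\<close>

text \<open>Rationals are coded by their reduced fractions, so that codes are unique.\<close>

definition rat_code :: "rat \<Rightarrow> nat" where
  "rat_code q = prod_encode (int_encode (fst (quotient_of q)), nat (snd (quotient_of q)))"

text \<open>Reals are given by fast-converging Cauchy sequences of rationals.\<close>

definition names :: "(nat \<Rightarrow> nat) \<Rightarrow> real \<Rightarrow> bool" where
  "names \<alpha> x \<longleftrightarrow>
     (\<exists>q :: nat \<Rightarrow> rat. (\<forall>n. \<alpha> n = rat_code (q n)) \<and> (\<forall>n i. \<bar>q n - q (n + i)\<bar> < 1 / 2 ^ n) \<and>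
        (\<lambda>n. real_of_rat (q n)) \<longlonglongrightarrow> x)"

definition represents_real :: "real set \<Rightarrow> ((nat \<Rightarrow> nat) \<Rightarrow> nat \<Rightarrow> nat) \<Rightarrow> (real \<Rightarrow> real) \<Rightarrow> bool" where
  "represents_real D F f \<longleftrightarrow> (\<forall>\<alpha> x. names \<alpha> x \<and> x \<in> D \<longrightarrow> names (F \<alpha>) (f x))"

definition represents_nat :: "real set \<Rightarrow> ((nat \<Rightarrow> nat) \<Rightarrow> nat) \<Rightarrow> (real \<Rightarrow> nat) \<Rightarrow> bool" where
  "represents_nat D F Y \<longleftrightarrow> (\<forall>\<alpha> x. names \<alpha> x \<and> x \<in> D \<longrightarrow> F \<alpha> = Y x)"

definition represents_rat :: "real set \<Rightarrow> ((nat \<Rightarrow> nat) \<Rightarrow> nat) \<Rightarrow> (real \<Rightarrow> rat) \<Rightarrow> bool" where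
  "represents_rat D F f \<longleftrightarrow> represents_nat D F (\<lambda>x. rat_code (f x))"

definition represents_set :: "real set \<Rightarrow> ((nat \<Rightarrow> nat) \<Rightarrow> nat) \<Rightarrow> real set \<Rightarrow> bool" where
  "represents_set D F A \<longleftrightarrow> represents_nat D F (\<lambda>x. if x \<in> A then 1 else 0)"

definition outputs_real :: "functional3 \<Rightarrow> low list \<Rightarrow> real \<Rightarrow> bool" where
  "outputs_real T xs x \<longleftrightarrow> (\<exists>\<alpha>. names \<alpha> x \<and> (\<forall>n. T (xs @ [Num n]) = Some (\<alpha> n)))"

text \<open>An output in \<open>\<real> \<times> \<real>\<close> is a pair of functionals, selected by an additional numerical argument.\<close>

definition outputs_real_pair :: "functional3 \<Rightarrow> low list \<Rightarrow> real \<Rightarrow> real \<Rightarrow> bool" where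
  "outputs_real_pair T xs x y \<longleftrightarrow>
     outputs_real T (xs @ [Num 0]) x \<and> outputs_real T (xs @ [Num 1]) y"

section \<open>Variation, Riemann integral and Laplace transform\<close>

definition increasing_points :: "(nat \<Rightarrow> real) \<Rightarrow> nat \<Rightarrow> bool" where
  "increasing_points x n \<longleftrightarrow> (\<forall>i<n. x i < x (Suc i))"

definition variation_sum :: "(real \<Rightarrow> real) \<Rightarrow> (nat \<Rightarrow> real) \<Rightarrow> nat \<Rightarrow> real" where
  "variation_sum f x n = (\<Sum>i<n. \<bar>f (x i) - f (x (Suc i))\<bar>)"

definition bounded_variation :: "real \<Rightarrow> real \<Rightarrow> (real \<Rightarrow> real) \<Rightarrow> bool" where
  "bounded_variation a b f \<longleftrightarrow>
     (\<exists>k\<^sub>0 :: nat. \<forall>x n. increasing_points x n \<and> x 0 = a \<and> x n = b \<longrightarrow> variation_sum f x n \<le> real k\<^sub>0)"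

definition has_variation :: "real \<Rightarrow> real \<Rightarrow> (real \<Rightarrow> real) \<Rightarrow> bool" where
  "has_variation a b f \<longleftrightarrow>
     (\<exists>V. isLub UNIV {variation_sum f x n |x n. increasing_points x n \<and> a \<le> x 0 \<and> x n \<le> b} V)"

text \<open>The library's integral is the strictly more general gauge integral.\<close>

definition has_riemann_integral :: "(real \<Rightarrow> real) \<Rightarrow> real \<Rightarrow> real \<Rightarrow> real \<Rightarrow> bool" where
  "has_riemann_integral f a b I \<longleftrightarrow>
     (\<forall>\<epsilon>>0. \<exists>\<delta>>0. \<forall>x t n.
        increasing_points x n \<and> x 0 = a \<and> x n = b \<and>
        (\<forall>i<n. x i \<le> t i \<and> t i \<le> x (Suc i) \<and> x (Suc i) - x i < \<delta>) \<longrightarrow>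
        \<bar>(\<Sum>i<n. f (t i) * (x (Suc i) - x i)) - I\<bar> < \<epsilon>)"

definition riemann_integrable :: "real \<Rightarrow> real \<Rightarrow> (real \<Rightarrow> real) \<Rightarrow> bool" where
  "riemann_integrable a b f \<longleftrightarrow> (\<exists>I. has_riemann_integral f a b I)"

definition has_laplace_transform :: "(real \<Rightarrow> real) \<Rightarrow> real \<Rightarrow> real \<Rightarrow> bool" where
  "has_laplace_transform f s L \<longleftrightarrow>
     (\<exists>J :: real \<Rightarrow> real.
        (\<forall>N>0. has_riemann_integral (\<lambda>t. exp (- s * t) * f t) 0 N (J N)) \<and> (J \<longlongrightarrow> L) at_top)"

section \<open>Realisers and tasks\<close>

definition cantor_realiser :: "functional3 \<Rightarrow> bool" where
  "cantor_realiser C \<longleftrightarrow>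
     (\<forall>F\<^sub>A F\<^sub>Y A Y. A \<subseteq> {0..1} \<and> represents_set {0..1} F\<^sub>A A \<and> represents_nat {0..1} F\<^sub>Y Y \<and> inj_on Y A \<longrightarrow>
        (\<exists>x \<in> {0..1} - A. outputs_real C [Fnl F\<^sub>A, Fnl F\<^sub>Y] x))"

definition weak_cantor_realiser :: "functional3 \<Rightarrow> bool" where
  "weak_cantor_realiser C \<longleftrightarrow>
     (\<forall>F\<^sub>A F\<^sub>Y A Y. A \<subseteq> {0..1} \<and> represents_set {0..1} F\<^sub>A A \<and> represents_nat {0..1} F\<^sub>Y Y \<and>
          bij_betw Y A UNIV \<longrightarrow>
        (\<exists>x \<in> {0..1} - A. outputs_real C [Fnl F\<^sub>A, Fnl F\<^sub>Y] x))"

definition nin_realiser :: "functional3 \<Rightarrow> bool" where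
  "nin_realiser T \<longleftrightarrow>
     (\<forall>F Y. represents_nat {0..1} F Y \<longrightarrow>
        (\<exists>x \<in> {0..1}. \<exists>y \<in> {0..1}. x \<noteq> y \<and> Y x = Y y \<and> outputs_real_pair T [Fnl F] x y))"

text \<open>
  The parameter \<open>V\<close> is \<^const>\<open>bounded_variation\<close> or \<^const>\<open>has_variation\<close>; in \<open>task3\<close> it can also
  be \<^const>\<open>riemann_integrable\<close>.
\<close>

definition task1 :: "(real \<Rightarrow> real \<Rightarrow> (real \<Rightarrow> real) \<Rightarrow> bool) \<Rightarrow> functional3 \<Rightarrow> bool" where
  "task1 V T \<longleftrightarrow>
     (\<forall>F f. represents_rat {0..1} F f \<and> V 0 1 (\<lambda>x. real_of_rat (f x)) \<longrightarrow>
        (\<exists>x \<in> {0..1}. \<exists>y \<in> {0..1}. x \<noteq> y \<and> f x = f y \<and> outputs_real_pair T [Fnl F] x y))"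

definition task2 :: "(real \<Rightarrow> real \<Rightarrow> (real \<Rightarrow> real) \<Rightarrow> bool) \<Rightarrow> functional3 \<Rightarrow> bool" where
  "task2 V T \<longleftrightarrow>
     (\<forall>F f. represents_real {0..1} F f \<and> V 0 1 f \<longrightarrow>
        (\<exists>x \<in> {0..1}. continuous (at x within {0..1}) f \<and> outputs_real T [Op F] x))"

definition task3 :: "(real \<Rightarrow> real \<Rightarrow> (real \<Rightarrow> real) \<Rightarrow> bool) \<Rightarrow> functional3 \<Rightarrow> bool" where
  "task3 V T \<longleftrightarrow>
     (\<forall>F f. represents_real {0..1} F f \<and> f ` {0..1} \<subseteq> {0..1} \<and> V 0 1 f \<and>
          has_riemann_integral f 0 1 0 \<longrightarrow>
        (\<exists>y \<in> {0..1}. f y = 0 \<and> outputs_real T [Op F] y))"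

definition task4 :: "(real \<Rightarrow> real \<Rightarrow> (real \<Rightarrow> real) \<Rightarrow> bool) \<Rightarrow> functional3 \<Rightarrow> bool" where
  "task4 V T \<longleftrightarrow>
     (\<forall>F G f g. represents_real UNIV F f \<and> represents_real UNIV G g \<and>
          (\<forall>a>0. V 0 a f \<and> V 0 a g) \<and>
          (\<forall>s\<ge>0. \<exists>L. has_laplace_transform f s L \<and> has_laplace_transform g s L) \<longrightarrow>
        (\<exists>x>0. f x = g x \<and> outputs_real T [Op F, Op G] x))"

abbreviation "sig_pair \<equiv> [Ty2, Ty0, Ty0]"
abbreviation "sig_real \<equiv> [Ty11, Ty0]"
abbreviation "sig_real2 \<equiv> [Ty11, Ty11, Ty0]"
abbreviation "sig_cantor \<equiv> [Ty2, Ty2, Ty0]"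

definition computes_with_exists2 ::
  "ty list \<Rightarrow> functional3 \<Rightarrow> ty list \<Rightarrow> (functional3 \<Rightarrow> bool) \<Rightarrow> bool" where
  "computes_with_exists2 \<tau> T \<sigma> P \<longleftrightarrow>
     (\<exists>C. P C \<and> kleene_computable_from \<sigma> C [Fnl3 \<tau> T, Low (Fnl exists2)])"

end

theory Submission
  imports Defs
begin

text \<open>
  Given \<open>A\<close> and \<open>Y\<close> injective on \<open>A\<close>, let \<open>w\<close> be \<open>2\<^bsup>-Y(x)\<^esup>\<close> on \<open>A\<close> and \<open>0\<close> elsewhere. All finite
  sums of values of \<open>w\<close> at distinct points are at most \<open>2\<close>, so \<open>w\<close> has bounded variation and
  Riemann integral \<open>0\<close>. It is injective on \<open>A\<close>, and discontinuous at each point of \<open>A\<close> because \<open>A\<close>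
  is countable. Hence solutions of tasks (1)--(3) for \<open>w\<close> lie outside \<open>A\<close>. For task (4) the line is
  folded into \<open>[0,1)\<close> by \<open>\<phi>(x) = \<bar>x\<bar> / (1 + \<bar>x\<bar>)\<close>: the functions \<open>w \<circ> \<phi>\<close> and \<open>0\<close> have the same
  Laplace transform, and \<open>\<phi>\<close> maps a point where they agree to a point outside \<open>A\<close>. A NIN-realiser
  applied to codes of rationals already performs task (1).
\<close>

section \<open>Uniform Kleene computability\<close>

text \<open>
  One index serves all parameters \<open>p\<close>; the length of the argument list is fixed because the
  permutations in S6 and the cut-off in S9 refer to it.
\<close>

definition uniformly_computable :: "('p \<Rightarrow> obj list) \<Rightarrow> ('p \<Rightarrow> nat) \<Rightarrow> bool" where
  "uniformly_computable A f \<longleftrightarrow> (\<exists>k e. \<forall>p. length (A p) = k \<and> kleene e (A p) (f p))"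

definition uniformly_denoted :: "('p \<Rightarrow> obj list) \<Rightarrow> ('p \<Rightarrow> low) \<Rightarrow> bool" where
  "uniformly_denoted A x \<longleftrightarrow> (\<exists>d. \<forall>p. denotes d (A p) (x p))"

abbreviation computable1 :: "(nat \<Rightarrow> nat) \<Rightarrow> bool" where
  "computable1 g \<equiv> uniformly_computable (\<lambda>n. [Low (Num n)]) g"

abbreviation computable2 :: "(nat \<Rightarrow> nat \<Rightarrow> nat) \<Rightarrow> bool" where
  "computable2 g \<equiv> uniformly_computable (\<lambda>(m, n). [Low (Num m), Low (Num n)]) (\<lambda>(m, n). g m n)"

section \<open>Rearranging and discarding arguments\<close>

text \<open>S9 runs an index on an initial segment of the arguments but wants that index as first
  argument; S2 supplies the numeral \<open>d\<close> and S4 puts it in front.\<close>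

lemma kleene_drop:
  assumes "kleene d args m"
  shows "kleene (list_encode [4, list_encode [9, length args], list_encode [2, d]]) (args @ args') m"
  by (rule S4, rule S2, rule S9, rule assms)

lemma kleene_select:
  assumes "distinct q" "set q \<subseteq> {..<k}"
  obtains e' where "\<And>args m. length args = k \<Longrightarrow> kleene e (map ((!) args) q) m \<Longrightarrow> kleene e' args m"
proof -
  define r where "r = filter (\<lambda>i. i \<notin> set q) [0..<k]"
  let ?d = "list_encode [4, list_encode [9, length q], list_encode [2, e]]"
  have "kleene (list_encode [6, list_encode (q @ r), ?d]) args m"
    if "length args = k" "kleene e (map ((!) args) q) m" for args m
  proof (rule S6)
    show "distinct (q @ r)" using assms by (auto simp: r_def)
    show "set (q @ r) = {..<length args}" using assms that by (auto simp: r_def)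
    show "kleene ?d (map ((!) args) (q @ r)) m"
      using kleene_drop[OF that(2), of "map ((!) args) r"] by simp
  qed
  then show thesis by (rule that)
qed

lemma uniformly_computable_select:
  assumes "uniformly_computable B f" "distinct q" "set q \<subseteq> {..<k}"
    and "\<And>p. length (A p) = k" "\<And>p. map ((!) (A p)) q = B p"
  shows "uniformly_computable A f"
proof -
  obtain e where e: "\<And>p. kleene e (B p) (f p)" using assms(1) unfolding uniformly_computable_def by auto
  obtain e' where "\<And>args m. length args = k \<Longrightarrow> kleene e (map ((!) args) q) m \<Longrightarrow> kleene e' args m"
    using kleene_select[OF assms(2,3)] by metis
  then have "\<forall>p. length (A p) = k \<and> kleene e' (A p) (f p)" using e assms(4,5) by metis
  then show ?thesis unfolding uniformly_computable_def by blast
qed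

lemma uniformly_computable_reparam:
  "uniformly_computable A f \<Longrightarrow> uniformly_computable (\<lambda>p. A (h p)) (\<lambda>p. f (h p))"
  unfolding uniformly_computable_def by blast

lemma uniformly_computable_length:
  assumes "uniformly_computable A f"
  obtains k where "\<And>p. length (A p) = k"
  using assms unfolding uniformly_computable_def by blast

lemma uniformly_computable_Cons:
  assumes "uniformly_computable A f"
  shows "uniformly_computable (\<lambda>p. x p # A p) f"
proof -
  obtain k where k: "\<And>p. length (A p) = k" using uniformly_computable_length[OF assms] by blast
  have "map ((!) (x p # A p)) [1..<Suc k] = A p" for p
    by (rule nth_equalityI) (auto simp: k simp del: upt_Suc)
  then show ?thesis
    by (intro uniformly_computable_select[OF assms, of "[1..<Suc k]" "Suc k"]) (auto simp: k)
qed

lemma uniformly_computable_append: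
  assumes "uniformly_computable A f" "\<And>p. length (R p) = k"
  shows "uniformly_computable (\<lambda>p. A p @ R p) f"
proof -
  obtain l e where e: "\<And>p. length (A p) = l \<and> kleene e (A p) (f p)"
    using assms(1) unfolding uniformly_computable_def by blast
  have "kleene (list_encode [4, list_encode [9, l], list_encode [2, e]]) (A p @ R p) (f p)" for p
    using kleene_drop[of e "A p" "f p" "R p"] e by simp
  then show ?thesis unfolding uniformly_computable_def using e assms(2)
    by (metis length_append)
qed

section \<open>Composition, recursion and functional application\<close>

text \<open>This is S4: the value of \<open>g\<close> becomes a new first argument, while all old
  arguments stay available to \<open>f\<close>.\<close>

lemma uniformly_computable_let:
  assumes "uniformly_computable A g" "uniformly_computable (\<lambda>p. Low (Num (g p)) # A p) f"
  shows "uniformly_computable A f"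
proof -
  obtain k e2 where "\<And>p. length (A p) = k \<and> kleene e2 (A p) (g p)"
    using assms(1) unfolding uniformly_computable_def by blast
  moreover obtain e1 where "\<And>p. kleene e1 (Low (Num (g p)) # A p) (f p)"
    using assms(2) unfolding uniformly_computable_def by blast
  ultimately have "\<forall>p. length (A p) = k \<and> kleene (list_encode [4, e1, e2]) (A p) (f p)"
    by (blast intro: S4)
  then show ?thesis unfolding uniformly_computable_def by blast
qed

lemma uniformly_computable_const:
  "(\<And>p. length (A p) = k) \<Longrightarrow> uniformly_computable A (\<lambda>p. q)"
  unfolding uniformly_computable_def by (blast intro: S2)

lemma computable1_id: "computable1 (\<lambda>n. n)"
  unfolding uniformly_computable_def
  by (rule exI[of _ 1], rule exI[of _ "list_encode [3]"]) (simp add: S3 del: list_encode.simps)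

lemma uniformly_computable_var:
  assumes "\<And>p. length (A p) = k" "i < k" "\<And>p. A p ! i = Low (Num (f p))"
  shows "uniformly_computable A f"
  by (rule uniformly_computable_select[of "\<lambda>p. [Low (Num (f p))]" _ "[i]" k])
     (use assms uniformly_computable_reparam[OF computable1_id, of f] in auto)

lemma computable1_Suc: "computable1 Suc"
  unfolding uniformly_computable_def
  by (rule exI[of _ 1], rule exI[of _ "list_encode [1]"]) (simp add: S1 del: list_encode.simps One_nat_def)

lemma uniformly_computable_comp1:
  assumes "computable1 g" "uniformly_computable A a"
  shows "uniformly_computable A (\<lambda>p. g (a p))"
proof -
  obtain k where k: "\<And>p. length (A p) = k" using uniformly_computable_length[OF assms(2)] by blast
  show ?thesis
    by (rule uniformly_computable_let[OF assms(2)])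
       (use uniformly_computable_append[OF uniformly_computable_reparam[OF assms(1), of a], of A] k
        in simp)
qed

lemma uniformly_computable_comp2:
  assumes "computable2 g" "uniformly_computable A a" "uniformly_computable A b"
  shows "uniformly_computable A (\<lambda>p. g (a p) (b p))"
proof -
  obtain k where k: "\<And>p. length (A p) = k" using uniformly_computable_length[OF assms(2)] by blast
  have "uniformly_computable (\<lambda>p. Low (Num (a p)) # Low (Num (b p)) # A p) (\<lambda>p. g (a p) (b p))"
    using uniformly_computable_append[OF uniformly_computable_reparam[OF assms(1), of "\<lambda>p. (a p, b p)"],
        of A] k by simp
  \<comment> \<open>\<open>b\<close> is computed first and \<open>a\<close> second, since each new
    value is put in front and \<open>g\<close> expects the order \<open>a\<close>,
    \<open>b\<close>.\<close>
  then show ?thesis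
    by (intro uniformly_computable_let[OF assms(3)]
          uniformly_computable_let[OF uniformly_computable_Cons[OF assms(2)]])
qed

text \<open>S5 passes the counter and the previous value ahead of the other arguments, which is the
  list assumed for \<open>s\<close>; induction on \<open>n\<close> then shows that one pair of
  indices works for all \<open>p\<close>.\<close>

lemma uniformly_computable_primrec:
  assumes "uniformly_computable A (\<lambda>p. g 0 p)"
    and "uniformly_computable (\<lambda>(n, k, p). Low (Num n) # Low (Num k) # A p) (\<lambda>(n, k, p). s n k p)"
    and "\<And>n p. g (Suc n) p = s n (g n p) p"
  shows "uniformly_computable (\<lambda>(n, p). Low (Num n) # A p) (\<lambda>(n, p). g n p)"
proof -
  obtain k e1 where e1: "\<And>p. length (A p) = k \<and> kleene e1 (A p) (g 0 p)"
    using assms(1) unfolding uniformly_computable_def by blast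
  obtain e2 where e2: "\<And>n k p. kleene e2 (Low (Num n) # Low (Num k) # A p) (s n k p)"
    using assms(2) unfolding uniformly_computable_def by auto
  have "kleene (list_encode [5, e1, e2]) (Low (Num n) # A p) (g n p)" for n p
  proof (induction n)
    case 0
    show ?case using e1 by (blast intro: S5_0)
  next
    case (Suc n)
    then show ?case unfolding assms(3) using e2 by (blast intro: S5_Suc)
  qed
  then have "\<forall>x. length (case x of (n, p) \<Rightarrow> Low (Num n) # A p) = Suc k \<and>
      kleene (list_encode [5, e1, e2]) (case x of (n, p) \<Rightarrow> Low (Num n) # A p) (case x of (n, p) \<Rightarrow> g n p)"
    using e1 by auto
  then show ?thesis unfolding uniformly_computable_def by blast
qed

text \<open>The parameter type is \<open>unit\<close> and the argument list is empty, so the initial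
  value is a single number, which S2 supplies.\<close>

lemma computable1_primrec:
  assumes "computable2 s" "\<And>n. g (Suc n) = s n (g n)"
  shows "computable1 g"
proof -
  have "uniformly_computable (\<lambda>(n, k, p::unit). [Low (Num n), Low (Num k)]) (\<lambda>(n, k, p). s n k)"
    using uniformly_computable_reparam[OF assms(1), of "\<lambda>(n, k, p). (n, k)"]
    by (simp add: case_prod_unfold)
  then have "uniformly_computable (\<lambda>(n, p::unit). [Low (Num n)]) (\<lambda>(n, p). g n)"
    using assms(2)
    by (intro uniformly_computable_primrec[where A = "\<lambda>_. []"] uniformly_computable_const) auto
  then show ?thesis
    using uniformly_computable_reparam[of "\<lambda>(n, p::unit). [Low (Num n)]" _ "\<lambda>n. (n, ())"] by fastforce
qed

text \<open>S8 for a type-two object at the head of the list: the function fed to \<open>F p\<close>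
  is computed from the same list with a number put in front, so that \<open>F p\<close> itself may
  be used in computing it.\<close>

lemma uniformly_computable_apply:
  assumes "uniformly_computable (\<lambda>(n, p). Low (Num n) # Low (Fnl (F p)) # R p) (\<lambda>(n, p). a p n)"
  shows "uniformly_computable (\<lambda>p. Low (Fnl (F p)) # R p) (\<lambda>p. F p (a p))"
proof -
  obtain k d where d: "\<And>n p. length (Low (Num n) # Low (Fnl (F p)) # R p) = k"
      "\<And>n p. kleene d (Low (Num n) # Low (Fnl (F p)) # R p) (a p n)"
    using assms unfolding uniformly_computable_def by auto
  have "kleene (list_encode [8, d]) (Low (Fnl (F p)) # R p) (F p (a p))" for p
    using d(2) by (intro S8[of _ _ "[d]" "[Fun (a p)]"]) (auto intro: den1)
  then have "\<forall>p. length (Low (Fnl (F p)) # R p) = k - 1 \<and>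
      kleene (list_encode [8, d]) (Low (Fnl (F p)) # R p) (F p (a p))"
    using d(1) by fastforce
  then show ?thesis unfolding uniformly_computable_def by blast
qed

lemma uniformly_computable_S7:
  "uniformly_computable (\<lambda>(f, n). [Low (Fun f), Low (Num n)]) (\<lambda>(f, n). f n)"
  unfolding uniformly_computable_def
  by (rule exI[of _ 2], rule exI[of _ "list_encode [7]"]) (auto simp: S7 simp del: list_encode.simps)

section \<open>Denoted objects and oracle calls\<close>

lemma uniformly_denoted_Num:
  "uniformly_computable A f \<Longrightarrow> uniformly_denoted A (\<lambda>p. Num (f p))"
  unfolding uniformly_computable_def uniformly_denoted_def by (blast intro: den0)

lemma uniformly_denoted_Fnl:
  "uniformly_computable (\<lambda>(\<alpha>, p). Low (Fun \<alpha>) # A p) (\<lambda>(\<alpha>, p). F p \<alpha>) \<Longrightarrow>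
    uniformly_denoted A (\<lambda>p. Fnl (F p))"
  unfolding uniformly_computable_def uniformly_denoted_def by (auto intro!: den2)

lemma uniformly_denoted_Op:
  "uniformly_computable (\<lambda>(\<alpha>, n, p). Low (Fun \<alpha>) # Low (Num n) # A p) (\<lambda>(\<alpha>, n, p). F p \<alpha> n) \<Longrightarrow>
    uniformly_denoted A (\<lambda>p. Op (F p))"
  unfolding uniformly_computable_def uniformly_denoted_def by (auto intro!: den11)

text \<open>The selection \<open>q\<close> moves the oracle to the head, where S8 expects it, and a
  single list of indices for its arguments serves all \<open>p\<close>. The conclusion is
  conditional on a value because the oracle may be partial.\<close>

lemma oracle_call:
  assumes "\<And>p. length (A p) = k" "distinct q" "set q \<subseteq> {..<k}" "\<And>p. map ((!) (A p)) q = \<Phi> # B p"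
    and "\<forall>x \<in> set xs. uniformly_denoted (\<lambda>p. \<Phi> # B p) x"
  shows "\<exists>e. \<forall>p m. obj_app \<Phi> (map (\<lambda>x. x p) xs) = Some m \<longrightarrow> kleene e (A p) m"
proof -
  have "\<exists>ds. \<forall>p. list_all2 (\<lambda>d x. denotes d (\<Phi> # B p) x) ds (map (\<lambda>x. x p) xs)"
    using assms(5)
  proof (induction xs)
    case Nil
    show ?case by auto
  next
    case (Cons x xs)
    then obtain ds where "\<And>p. list_all2 (\<lambda>d x. denotes d (\<Phi> # B p) x) ds (map (\<lambda>x. x p) xs)"
      by auto
    moreover obtain d where "\<And>p. denotes d (\<Phi> # B p) (x p)"
      using Cons.prems unfolding uniformly_denoted_def by auto
    ultimately show ?case by (intro exI[of _ "d # ds"]) simp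
  qed
  then obtain ds where "\<And>p. list_all2 (\<lambda>d x. denotes d (\<Phi> # B p) x) ds (map (\<lambda>x. x p) xs)" by blast
  then have "kleene (list_encode (8 # ds)) (\<Phi> # B p) m"
    if "obj_app \<Phi> (map (\<lambda>x. x p) xs) = Some m" for p m using that by (blast intro: S8)
  moreover obtain e' where
    "\<And>args m. length args = k \<Longrightarrow> kleene (list_encode (8 # ds)) (map ((!) args) q) m \<Longrightarrow> kleene e' args m"
    using kleene_select[OF assms(2,3)] by metis
  ultimately have "kleene e' (A p) m" if "obj_app \<Phi> (map (\<lambda>x. x p) xs) = Some m" for p m
    using that assms(1,4) by simp
  then show ?thesis by blast
qed

text \<open>Kleene computations are single-valued, so each index determines a partial functional,
  undefined exactly where the computation has no value.\<close>

lemma kleene_computable_from_index: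
  obtains C where "kleene_computable_from \<sigma> C oracles"
    and "\<And>xs m. map ty_of xs = \<sigma> \<Longrightarrow> kleene e (map Low xs @ oracles) m \<Longrightarrow> C xs = Some m"
proof -
  define C where "C xs = (if \<exists>m. kleene e (map Low xs @ oracles) m
      then Some (THE m. kleene e (map Low xs @ oracles) m) else None)" for xs
  have C: "C xs = Some m" if "kleene e (map Low xs @ oracles) m" for xs m
  proof -
    have "(THE m. kleene e (map Low xs @ oracles) m) = m"
      by (rule the_equality, rule that, rule kleene_deterministic(1)[OF that])
    then show ?thesis unfolding C_def using that by metis
  qed
  moreover have "kleene e (map Low xs @ oracles) m" if "C xs = Some m" for xs m
    using that C C_def by (metis option.distinct(1) option.inject)
  ultimately have "kleene_computable_from \<sigma> C oracles"
    unfolding kleene_computable_from_def by blast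
  then show thesis using C that by blast
qed

section \<open>Arithmetic on codes\<close>

lemma computable2_add: "computable2 (+)"
proof (rule uniformly_computable_primrec[where A = "\<lambda>y. [Low (Num y)]" and s = "\<lambda>n k y. Suc k"])
  show "computable1 (\<lambda>y. 0 + y)" using computable1_id by simp
  show "uniformly_computable (\<lambda>(n, k, y). [Low (Num n), Low (Num k), Low (Num y)]) (\<lambda>(n, k, y). Suc k)"
    using uniformly_computable_comp1[OF computable1_Suc uniformly_computable_var[where
          A = "\<lambda>(n, k, y). [Low (Num n), Low (Num k), Low (Num y)]" and k = 3 and i = 1
          and f = "\<lambda>(n, k, y). k"]]
    by (simp add: case_prod_unfold)
qed simp

lemma computable1_pred: "computable1 (\<lambda>n. n - 1)"
  by (rule computable1_primrec[where s = "\<lambda>n k. n"])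
     (auto intro!: uniformly_computable_var[where k = 2 and i = 0])

lemma computable2_fst: "computable2 (\<lambda>m n. m)" and computable2_snd: "computable2 (\<lambda>m n. n)"
  by (rule uniformly_computable_var[where k = 2 and i = 0]; auto)
     (rule uniformly_computable_var[where k = 2 and i = 1]; auto)

text \<open>The recursion runs on the subtrahend, so subtraction is first obtained with its
  arguments exchanged.\<close>

lemma computable2_diff: "computable2 (-)"
proof -
  have "computable2 (\<lambda>n y. y - n)"
  proof (rule uniformly_computable_primrec[where A = "\<lambda>y. [Low (Num y)]" and s = "\<lambda>n k y. k - 1"])
    show "computable1 (\<lambda>y. y - 0)" using computable1_id by simp
    show "uniformly_computable (\<lambda>(n, k, y). [Low (Num n), Low (Num k), Low (Num y)]) (\<lambda>(n, k, y). k - 1)"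
      using uniformly_computable_comp1[OF computable1_pred uniformly_computable_var[where
            A = "\<lambda>(n, k, y). [Low (Num n), Low (Num k), Low (Num y)]" and k = 3 and i = 1
            and f = "\<lambda>(n, k, y). k"]]
      by (simp add: case_prod_unfold)
  qed simp
  from uniformly_computable_comp2[OF this computable2_snd computable2_fst] show ?thesis
    by (simp add: case_prod_unfold)
qed

lemma computable2_const: "computable2 (\<lambda>m n. q)"
  by (simp add: case_prod_unfold uniformly_computable_const)

lemma computable2_comp2:
  assumes "computable2 g" "computable2 a" "computable2 b"
  shows "computable2 (\<lambda>m n. g (a m n) (b m n))"
  using uniformly_computable_comp2[OF assms] by (simp add: case_prod_unfold)

lemma computable2_comp1:
  assumes "computable1 g" "computable2 a"
  shows "computable2 (\<lambda>m n. g (a m n))"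
  using uniformly_computable_comp1[OF assms] by (simp add: case_prod_unfold)

lemma computable1_triangle: "computable1 triangle"
  by (rule computable1_primrec[where s = "\<lambda>n k. k + Suc n"])
     (intro computable2_comp2[OF computable2_add] computable2_comp1[OF computable1_Suc]
       computable2_fst computable2_snd, simp)

lemma computable1_power2: "computable1 (\<lambda>n. 2 ^ n)"
  by (rule computable1_primrec[where s = "\<lambda>n k. k + k"])
     (intro computable2_comp2[OF computable2_add] computable2_snd, simp)

text \<open>The two halves of \<open>Suc n\<close>, one rounded up and one rounded down, add up to
  \<open>Suc n\<close>. Since an integer \<open>a\<close> is coded by \<open>2 * a\<close> or
  \<open>- 2 * a - 1\<close>, half of its code, rounded up, is \<open>\<bar>a\<bar>\<close>.\<close>

lemma computable1_ceiling_half: "computable1 (\<lambda>n. Suc n div 2)"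
  by (rule computable1_primrec[where s = "\<lambda>n k. Suc n - k"])
     (intro computable2_comp2[OF computable2_diff] computable2_comp1[OF computable1_Suc]
       computable2_fst computable2_snd, presburger)

section \<open>Inverting the pairing function\<close>

text \<open>This is the largest \<open>r\<close> with \<open>triangle r \<le> m\<close>. Truncated
  subtraction makes the increment \<open>1\<close> exactly when the next triangular number is at
  most \<open>Suc m\<close>, and \<open>0\<close> otherwise.\<close>

fun triangle_root :: "nat \<Rightarrow> nat" where
  "triangle_root 0 = 0"
| "triangle_root (Suc m) = triangle_root m + (1 - (triangle (Suc (triangle_root m)) - Suc m))"

lemma computable1_triangle_root: "computable1 triangle_root"
  by (rule computable1_primrec[where s = "\<lambda>n k. k + (1 - (triangle (Suc k) - Suc n))"])
     (intro computable2_comp2[OF computable2_add] computable2_comp2[OF computable2_diff]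
       computable2_comp1[OF computable1_Suc] computable2_comp1[OF computable1_triangle]
       computable2_fst computable2_snd computable2_const, simp)

lemma triangle_root_bounds:
  "triangle (triangle_root m) \<le> m \<and> m < triangle (Suc (triangle_root m))"
proof (induction m)
  case (Suc m)
  show ?case
  proof (cases "triangle (Suc (triangle_root m)) \<le> Suc m")
    case True
    then have "triangle_root (Suc m) = Suc (triangle_root m)" by simp
    with True Suc show ?thesis by simp
  next
    case False
    then have "triangle_root (Suc m) = triangle_root m" by simp
    with False Suc show ?thesis by simp
  qed
qed simp

text \<open>The pairing puts \<open>(a, b)\<close> at \<open>triangle (a + b) + a\<close>, which
  lies before the next triangular number; the bounds on the root then leave only
  \<open>a + b\<close>.\<close>

lemma triangle_root_prod_encode: "triangle_root (prod_encode (a, b)) = a + b"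
proof -
  have mono: "mono triangle" by (rule incseq_SucI) simp
  let ?r = "triangle_root (prod_encode (a, b))"
  have "triangle ?r \<le> triangle (a + b) + a" "triangle (a + b) + a < triangle (Suc ?r)"
    using triangle_root_bounds[of "prod_encode (a, b)"] by (auto simp: prod_encode_def)
  moreover have "triangle (a + b) + a < triangle (Suc (a + b))" by simp
  ultimately have "triangle ?r < triangle (Suc (a + b))" "triangle (a + b) < triangle (Suc ?r)" by linarith+
  then have "?r < Suc (a + b)" "a + b < Suc ?r" using mono by (meson leD leI monoD)+
  then show ?thesis by simp
qed

section \<open>Codes of the weights\<close>

text \<open>The two values encode the pairs \<open>(0, 1)\<close> and \<open>(2, 2 ^ k)\<close>,
  hence the rationals \<open>0\<close> and \<open>1 / 2 ^ k\<close>: the integer \<open>1\<close> is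
  coded by \<open>2\<close>. The first argument will be the value of a characteristic
  function.\<close>

definition weight_code :: "nat \<Rightarrow> nat \<Rightarrow> nat" where
  "weight_code a k = (if a = 0 then 1 else triangle (2 + 2 ^ k) + 2)"

text \<open>The case distinction is a recursion on the first argument whose step does not look at
  the previous value.\<close>

lemma computable2_weight_code: "computable2 weight_code"
proof (rule uniformly_computable_primrec[where A = "\<lambda>y. [Low (Num y)]"
      and s = "\<lambda>n k y. triangle (2 + 2 ^ y) + 2"])
  show "computable1 (\<lambda>y. weight_code 0 y)"
    by (simp add: weight_code_def uniformly_computable_const)
  show "uniformly_computable (\<lambda>(n, k, y). [Low (Num n), Low (Num k), Low (Num y)])
     (\<lambda>(n, k, y). triangle (2 + 2 ^ y) + 2)"
    unfolding case_prod_unfold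
    by (intro uniformly_computable_comp2[OF computable2_add] uniformly_computable_comp1[OF computable1_triangle]
        uniformly_computable_comp1[OF computable1_power2] uniformly_computable_const[where k = 3]
        uniformly_computable_var[where k = 3 and i = 2]) auto
qed (simp add: weight_code_def)

lemma rat_code_0: "rat_code 0 = 1"
  by (simp add: rat_code_def prod_encode_def int_encode_def sum_encode_def)

lemma rat_code_inverse_power2: "rat_code (1 / 2 ^ k) = triangle (2 + 2 ^ k) + 2"
proof -
  have "quotient_of (1 / 2 ^ k) = (1, 2 ^ k)"
    using quotient_of_Fract[of 1 "2 ^ k"] by (simp add: Fract_of_int_quotient Rat.normalize_def)
  then show ?thesis
    by (simp add: rat_code_def prod_encode_def int_encode_def sum_encode_def nat_power_eq)
qed

text \<open>Reduced fractions are unique, and \<open>nat\<close> loses nothing on denominators since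
  these are positive. Injectivity will turn a collision of codes into a collision of rational
  values.\<close>

lemma inj_rat_code: "inj rat_code"
proof (rule injI)
  fix p q assume "rat_code p = rat_code q"
  then have "fst (quotient_of p) = fst (quotient_of q)" "nat (snd (quotient_of p)) = nat (snd (quotient_of q))"
    by (auto simp: rat_code_def int_encode_eq)
  moreover have "snd (quotient_of p) > 0" "snd (quotient_of q) > 0" by (rule quotient_of_denom_pos')+
  ultimately have "quotient_of p = quotient_of q" by (simp add: prod_eq_iff)
  then show "p = q" by (simp add: quotient_of_inject)
qed

text \<open>
  The map \<open>x \<mapsto> \<bar>x\<bar> / (1 + \<bar>x\<bar>)\<close> is 1-Lipschitz and sends the reduced fraction \<open>a/b\<close> to the
  reduced fraction \<open>\<bar>a\<bar>/(b + \<bar>a\<bar>)\<close>, so it acts on names of reals termwise and without cancellation.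
\<close>

definition squash :: "'a :: linordered_field \<Rightarrow> 'a" where
  "squash x = \<bar>x\<bar> / (1 + \<bar>x\<bar>)"

text \<open>On the code of a reduced fraction \<open>a / b\<close>, \<open>c\<close> is the coded
  numerator, \<open>h\<close> is \<open>\<bar>a\<bar>\<close> and \<open>s - c\<close> is
  \<open>b\<close>; the result encodes the pair of \<open>2 * \<bar>a\<bar>\<close> and
  \<open>b + \<bar>a\<bar>\<close>.\<close>

definition squash_code :: "nat \<Rightarrow> nat" where
  "squash_code m =
     (let s = triangle_root m; c = m - triangle s; h = Suc c div 2
      in triangle ((h + h) + ((s - c) + h)) + (h + h))"

lemma computable1_squash_code: "computable1 squash_code"
  unfolding squash_code_def Let_def
  by (intro uniformly_computable_comp2[OF computable2_add] uniformly_computable_comp2[OF computable2_diff]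
       uniformly_computable_comp1[OF computable1_triangle] uniformly_computable_comp1[OF computable1_triangle_root]
       uniformly_computable_comp1[OF computable1_ceiling_half] computable1_id)

lemma squash_code_rat_code: "squash_code (rat_code q) = rat_code (squash q)"
proof -
  obtain a b where ab: "quotient_of q = (a, b)" by fastforce
  then have b: "b > 0" and cop: "coprime a b"
    by (auto intro: quotient_of_denom_pos quotient_of_coprime)
  have q: "q = of_int a / of_int b" using ab by (rule quotient_of_div)
  have "squash q = of_int \<bar>a\<bar> / of_int (b + \<bar>a\<bar>)"
    using b by (simp add: squash_def q field_simps)
  moreover have "coprime \<bar>a\<bar> (b + \<bar>a\<bar>)" using cop gcd_add1[of b "\<bar>a\<bar>"]
    by (simp add: coprime_iff_gcd_eq_1 gcd.commute)
  ultimately have "quotient_of (squash q) = (\<bar>a\<bar>, b + \<bar>a\<bar>)"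
    using b quotient_of_Fract[of "\<bar>a\<bar>" "b + \<bar>a\<bar>"]
    by (simp add: Fract_of_int_quotient Rat.normalize_def coprime_iff_gcd_eq_1)
  then have R: "rat_code (squash q) = prod_encode (2 * nat \<bar>a\<bar>, nat b + nat \<bar>a\<bar>)"
    using b by (simp add: rat_code_def int_encode_def sum_encode_def nat_add_distrib)
  define c where "c = int_encode a"
  have h: "Suc c div 2 = nat \<bar>a\<bar>"
    by (cases "a \<ge> 0") (auto simp: c_def int_encode_def sum_encode_def nat_diff_distrib')
  have m: "rat_code q = prod_encode (c, nat b)" by (simp add: rat_code_def ab c_def)
  have "rat_code q - triangle (c + nat b) = c" by (simp add: m prod_encode_def)
  moreover have "triangle_root (rat_code q) = c + nat b" by (simp add: m triangle_root_prod_encode)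
  ultimately show ?thesis
    unfolding R squash_code_def Let_def by (simp add: h prod_encode_def mult_2)
qed

text \<open>Over a common denominator the difference is \<open>\<bar>x\<bar> - \<bar>y\<bar>\<close>
  divided by a product that is at least \<open>1\<close>. The constant \<open>1\<close> lets the
  rate \<open>1 / 2 ^ n\<close> required of names survive.\<close>

lemma squash_Lipschitz: "\<bar>squash x - squash y\<bar> \<le> \<bar>x - y :: 'a :: linordered_field\<bar>"
proof -
  have pos: "1 + \<bar>x\<bar> > 0" "1 + \<bar>y\<bar> > 0" by (simp_all add: add_pos_nonneg)
  then have "squash x - squash y = (\<bar>x\<bar> - \<bar>y\<bar>) / ((1 + \<bar>x\<bar>) * (1 + \<bar>y\<bar>))"
    by (simp add: squash_def field_simps)
  moreover have "1 * 1 \<le> (1 + \<bar>x\<bar>) * (1 + \<bar>y\<bar>)" by (rule mult_mono) auto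
  ultimately have "\<bar>squash x - squash y\<bar> \<le> \<bar>\<bar>x\<bar> - \<bar>y\<bar>\<bar> / 1"
    using pos by (simp add: abs_mult divide_le_eq mult_le_cancel_left1)
  also have "\<dots> \<le> \<bar>x - y\<bar>" using abs_triangle_ineq3[of x y] by simp
  finally show ?thesis .
qed

lemma names_squash:
  assumes "names \<alpha> x"
  shows "names (\<lambda>n. squash_code (\<alpha> n)) (squash x)"
proof -
  obtain q :: "nat \<Rightarrow> rat" where q: "\<And>n. \<alpha> n = rat_code (q n)" "\<And>n i. \<bar>q n - q (n + i)\<bar> < 1 / 2 ^ n"
    "(\<lambda>n. real_of_rat (q n)) \<longlonglongrightarrow> x"
    using assms unfolding names_def by blast
  have "(\<lambda>n. squash (real_of_rat (q n))) \<longlonglongrightarrow> squash x"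
    unfolding squash_def by (intro tendsto_intros q) auto
  moreover have "squash (real_of_rat r) = real_of_rat (squash r)" for r
    by (simp add: squash_def of_rat_divide of_rat_add)
  moreover have "\<bar>squash (q n) - squash (q (n + i))\<bar> < 1 / 2 ^ n" for n i
    using squash_Lipschitz q(2) by (rule le_less_trans)
  ultimately show ?thesis
    unfolding names_def by (intro exI[of _ "\<lambda>n. squash (q n)"]) (simp add: q squash_code_rat_code)
qed

lemma names_of_rat: "names (\<lambda>n. rat_code q) (real_of_rat q)"
  unfolding names_def by (rule exI[of _ "\<lambda>_. q"]) simp

section \<open>Functions with bounded finite sums\<close>

text \<open>Summability over a possibly uncountable set. This single condition yields bounded
  variation, existence of the variation, integral \<open>0\<close> and Laplace transform
  \<open>0\<close>.\<close>

definition sums_bounded :: "real set \<Rightarrow> (real \<Rightarrow> real) \<Rightarrow> real \<Rightarrow> bool" where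
  "sums_bounded D h B \<longleftrightarrow> (\<forall>x \<in> D. 0 \<le> h x) \<and> (\<forall>S. finite S \<and> S \<subseteq> D \<longrightarrow> sum h S \<le> B)"

lemma sums_bounded_subset: "sums_bounded D h B \<Longrightarrow> D' \<subseteq> D \<Longrightarrow> sums_bounded D' h B"
  unfolding sums_bounded_def by blast

lemma sums_bounded_reindex:
  assumes "sums_bounded D h B" "finite I" "inj_on y I" "y ` I \<subseteq> D"
  shows "(\<Sum>i\<in>I. h (y i)) \<le> B"
proof -
  have "(\<Sum>i\<in>I. h (y i)) = sum h (y ` I)" using assms(3) by (simp add: sum.reindex)
  also have "\<dots> \<le> B" using assms unfolding sums_bounded_def by blast
  finally show ?thesis .
qed

lemma sums_bounded_compose:
  assumes "sums_bounded D h B" "inj_on y E" "y ` E \<subseteq> D"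
  shows "sums_bounded E (\<lambda>x. h (y x)) B"
  unfolding sums_bounded_def
proof (intro conjI ballI allI impI)
  show "0 \<le> h (y x)" if "x \<in> E" for x using assms that unfolding sums_bounded_def by auto
  show "(\<Sum>x\<in>S. h (y x)) \<le> B" if "finite S \<and> S \<subseteq> E" for S
    using that assms(2,3) by (intro sums_bounded_reindex[OF assms(1)]) (auto intro: inj_on_subset)
qed

lemma sums_bounded_mono:
  assumes "sums_bounded D h B" "\<And>x. x \<in> D \<Longrightarrow> 0 \<le> g x \<and> g x \<le> h x"
  shows "sums_bounded D g B"
  unfolding sums_bounded_def
proof (intro conjI ballI allI impI)
  show "0 \<le> g x" if "x \<in> D" for x using assms that by blast
  fix S assume S: "finite S \<and> S \<subseteq> D"
  then have "sum g S \<le> sum h S" using assms(2) by (intro sum_mono) blast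
  also have "\<dots> \<le> B" using S assms(1) unfolding sums_bounded_def by blast
  finally show "sum g S \<le> B" .
qed

lemma sums_bounded_zero: "sums_bounded D (\<lambda>_. 0) 0"
  unfolding sums_bounded_def by simp

lemma sums_bounded_nonneg: "sums_bounded D h B \<Longrightarrow> 0 \<le> B"
  unfolding sums_bounded_def by (metis empty_subsetI finite.emptyI sum.empty)

section \<open>Variation sums\<close>

lemma increasing_points_less:
  assumes "increasing_points x n" "i < j" "j \<le> n"
  shows "x i < x j"
  using assms(2,3)
proof (induction j)
  case (Suc j)
  have "x j < x (Suc j)" using assms(1) Suc.prems unfolding increasing_points_def by simp
  then show ?case using Suc by (cases "i = j") auto
qed simp

lemma increasing_points_le:
  "increasing_points x n \<Longrightarrow> i \<le> j \<Longrightarrow> j \<le> n \<Longrightarrow> x i \<le> x j"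
  using increasing_points_less[of x n i j] by (cases "i = j") auto

text \<open>Each increment is at most the sum of the two values, and each partition point occurs at
  most once as a left end and once as a right end; this gives the factor \<open>2\<close>.\<close>

lemma variation_sum_le:
  assumes h: "sums_bounded {a..b} h B" and x: "increasing_points x n" "a \<le> x 0" "x n \<le> b"
  shows "variation_sum h x n \<le> 2 * B"
proof -
  have D: "x i \<in> {a..b}" if "i \<le> n" for i
    using increasing_points_le[OF x(1), of 0 i] increasing_points_le[OF x(1), of i n] x that by auto
  have inj: "inj_on x {..n}"
    by (rule inj_onI) (metis increasing_points_less[OF x(1)] atMost_iff less_irrefl nat_neq_iff)
  have "variation_sum h x n \<le> (\<Sum>i<n. h (x i) + h (x (Suc i)))"
    unfolding variation_sum_def
  proof (rule sum_mono)
    fix i assume "i \<in> {..<n}"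
    then have "0 \<le> h (x i)" "0 \<le> h (x (Suc i))" using h D unfolding sums_bounded_def by auto
    then show "\<bar>h (x i) - h (x (Suc i))\<bar> \<le> h (x i) + h (x (Suc i))" by simp
  qed
  also have "\<dots> = (\<Sum>i<n. h (x i)) + (\<Sum>i\<in>{..<n}. h ((x \<circ> Suc) i))" by (simp add: sum.distrib)
  also have "(\<Sum>i<n. h (x i)) \<le> B"
    using D by (intro sums_bounded_reindex[OF h] inj_on_subset[OF inj]) auto
  also have "(\<Sum>i\<in>{..<n}. h ((x \<circ> Suc) i)) \<le> B"
  proof (rule sums_bounded_reindex[OF h])
    show "inj_on (x \<circ> Suc) {..<n}" by (intro comp_inj_on inj_on_subset[OF inj]) auto
    show "(x \<circ> Suc) ` {..<n} \<subseteq> {a..b}" using D by fastforce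
  qed simp
  finally show ?thesis by simp
qed

lemma bounded_variation_sums_bounded:
  assumes "sums_bounded {a..b} h B"
  shows "bounded_variation a b h"
proof -
  obtain k :: nat where "2 * B \<le> real k" using real_arch_simple by blast
  then show ?thesis
    unfolding bounded_variation_def using variation_sum_le[OF assms]
    by (intro exI[of _ k]) (smt (verit))
qed

lemma has_variation_sums_bounded:
  assumes "sums_bounded {a..b} h B" "a \<le> b"
  shows "has_variation a b h"
  unfolding has_variation_def
proof (rule reals_complete)
  let ?S = "{variation_sum h x n |x n. increasing_points x n \<and> a \<le> x 0 \<and> x n \<le> b}"
  \<comment> \<open>The single point \<open>a\<close> is a partition with \<open>n = 0\<close>, so
    the set is nonempty as completeness requires.\<close>
  have "variation_sum h (\<lambda>_. a) 0 \<in> ?S" using assms(2) by (force simp: increasing_points_def)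
  then show "\<exists>X. X \<in> ?S" by blast
  show "\<exists>Y. isUb UNIV ?S Y"
    using variation_sum_le[OF assms(1)] by (auto simp: isUb_def setle_def)
qed

text \<open>
  A point is the tag of at most two intervals, and these are adjacent; hence the tags of the
  even (odd) intervals are distinct.
\<close>

lemma has_riemann_integral_sums_bounded:
  assumes h: "sums_bounded {a..b} h B"
  shows "has_riemann_integral h a b 0"
  unfolding has_riemann_integral_def
proof (intro allI impI)
  fix \<epsilon> :: real assume "\<epsilon> > 0"
  have B: "0 \<le> B" using sums_bounded_nonneg[OF h] .
  \<comment> \<open>The values at the tags add up to at most \<open>2 * B\<close>, so a mesh below
    \<open>\<delta>\<close> keeps Riemann sums at most \<open>\<delta> * (2 * B)\<close>. The added
    \<open>1\<close> covers \<open>B = 0\<close> and makes the bound strict.\<close>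
  define \<delta> where "\<delta> = \<epsilon> / (2 * B + 1)"
  have \<delta>: "\<delta> > 0" "\<delta> * (2 * B) < \<epsilon>" using B \<open>\<epsilon> > 0\<close> by (auto simp: \<delta>_def field_simps)
  show "\<exists>\<delta>>0. \<forall>x t n. increasing_points x n \<and> x 0 = a \<and> x n = b \<and>
        (\<forall>i<n. x i \<le> t i \<and> t i \<le> x (Suc i) \<and> x (Suc i) - x i < \<delta>) \<longrightarrow>
        \<bar>(\<Sum>i<n. h (t i) * (x (Suc i) - x i)) - 0\<bar> < \<epsilon>"
  proof (intro exI[of _ \<delta>] conjI allI impI, rule \<delta>(1))
    fix x t n
    assume A: "increasing_points x n \<and> x 0 = a \<and> x n = b \<and>
        (\<forall>i<n. x i \<le> t i \<and> t i \<le> x (Suc i) \<and> x (Suc i) - x i < \<delta>)"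
    then have x: "increasing_points x n" "x 0 = a" "x n = b"
      and t: "\<And>i. i < n \<Longrightarrow> x i \<le> t i" "\<And>i. i < n \<Longrightarrow> t i \<le> x (Suc i)"
      and fine: "\<And>i. i < n \<Longrightarrow> x (Suc i) - x i < \<delta>" by auto
    have D: "t i \<in> {a..b}" if "i < n" for i
      using increasing_points_le[OF x(1), of 0 i] increasing_points_le[OF x(1), of "Suc i" n] x
        t[OF that] that by auto
    have less: "t i < t j" if "Suc i < j" "j < n" for i j
      using increasing_points_less[OF x(1), of "Suc i" j] t[of i] t[of j] that by auto
    have inj: "inj_on t {i \<in> {..<n}. even i = c}" for c
    proof (rule inj_onI, rule ccontr)
      fix i j assume ij: "i \<in> {i \<in> {..<n}. even i = c}" "j \<in> {i \<in> {..<n}. even i = c}" "t i = t j" "i \<noteq> j"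
      then have "j \<noteq> Suc i" "i \<noteq> Suc j" by auto
      then have "Suc i < j \<or> Suc j < i" using ij(4) by linarith
      then show False using less[of i j] less[of j i] ij by auto
    qed
    have part: "(\<Sum>i\<in>{i \<in> {..<n}. even i = c}. h (t i)) \<le> B" for c
      using D by (intro sums_bounded_reindex[OF h _ inj]) auto
    have "(\<Sum>i<n. h (t i)) = (\<Sum>i\<in>{i \<in> {..<n}. even i = True} \<union> {i \<in> {..<n}. even i = False}. h (t i))"
      by (rule sum.cong) auto
    also have "\<dots> = (\<Sum>i\<in>{i \<in> {..<n}. even i = True}. h (t i)) + (\<Sum>i\<in>{i \<in> {..<n}. even i = False}. h (t i))"
      by (rule sum.union_disjoint) auto
    also have "\<dots> \<le> 2 * B" using part[of True] part[of False] by linarith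
    finally have le: "(\<Sum>i<n. h (t i)) \<le> 2 * B" .
    have nonneg: "0 \<le> h (t i)" if "i < n" for i using h D[OF that] unfolding sums_bounded_def by blast
    have step: "x i < x (Suc i)" if "i < n" for i using x(1) that unfolding increasing_points_def by blast
    have "(\<Sum>i<n. h (t i) * (x (Suc i) - x i)) \<le> (\<Sum>i<n. h (t i) * \<delta>)"
      using nonneg fine by (intro sum_mono mult_left_mono) (auto intro: less_imp_le)
    also have "\<dots> = \<delta> * (\<Sum>i<n. h (t i))" by (simp add: sum_distrib_left mult.commute)
    also have "\<dots> \<le> \<delta> * (2 * B)" using le \<delta>(1) by (intro mult_left_mono) auto
    also have "\<dots> < \<epsilon>" by (rule \<delta>(2))
    finally have "(\<Sum>i<n. h (t i) * (x (Suc i) - x i)) < \<epsilon>" .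
    moreover have "0 \<le> (\<Sum>i<n. h (t i) * (x (Suc i) - x i))"
      using nonneg step by (intro sum_nonneg mult_nonneg_nonneg) (auto intro: less_imp_le)
    ultimately show "\<bar>(\<Sum>i<n. h (t i) * (x (Suc i) - x i)) - 0\<bar> < \<epsilon>" by simp
  qed
qed

text \<open>The exponential factor is at most \<open>1\<close> for \<open>s, t \<ge> 0\<close>, so
  the integrand inherits the bound on finite sums. Every truncated integral is therefore
  \<open>0\<close>, and so is the limit.\<close>

lemma has_laplace_transform_sums_bounded:
  assumes h: "sums_bounded {0..} h B" and "s \<ge> 0"
  shows "has_laplace_transform h s 0"
proof -
  have "sums_bounded {0..N} (\<lambda>t. exp (- s * t) * h t) B" for N
  proof (rule sums_bounded_mono[OF sums_bounded_subset[OF h]])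
    fix t assume t: "t \<in> {0..N}"
    then have "0 \<le> h t" using h unfolding sums_bounded_def by auto
    moreover have "exp (- s * t) \<le> 1" using t \<open>s \<ge> 0\<close> by simp
    ultimately show "0 \<le> exp (- s * t) * h t \<and> exp (- s * t) * h t \<le> h t"
      by (simp add: mult_left_le_one_le)
  qed auto
  then have "\<forall>N>0. has_riemann_integral (\<lambda>t. exp (- s * t) * h t) 0 N 0"
    using has_riemann_integral_sums_bounded by blast
  then show ?thesis unfolding has_laplace_transform_def by (intro exI[of _ "\<lambda>_. 0"]) simp
qed

section \<open>The weight of a countable set\<close>

definition weight :: "real set \<Rightarrow> (real \<Rightarrow> nat) \<Rightarrow> real \<Rightarrow> rat" where
  "weight A Y x = (if x \<in> A then 1 / 2 ^ Y x else 0)"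

lemma weight_eq_0_iff: "weight A Y x = 0 \<longleftrightarrow> x \<notin> A"
  by (simp add: weight_def)

lemma of_rat_weight: "real_of_rat (weight A Y x) = (if x \<in> A then (1 / 2) ^ Y x else 0)"
  by (simp add: weight_def of_rat_divide of_rat_power power_one_over)

lemma weight_bounds: "0 \<le> real_of_rat (weight A Y x)" "real_of_rat (weight A Y x) \<le> 1"
  by (simp_all add: of_rat_weight power_le_one)

text \<open>If \<open>x\<close> were in \<open>A\<close>, the common value would be nonzero, so
  \<open>y\<close> would be in \<open>A\<close> too; a power of two determines its exponent, which
  contradicts injectivity of \<open>Y\<close>.\<close>

lemma weight_eq_imp_notin:
  assumes "inj_on Y A" "weight A Y x = weight A Y y" "x \<noteq> y"
  shows "x \<notin> A"
proof
  assume x: "x \<in> A"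
  then have y: "y \<in> A" using assms(2) weight_eq_0_iff by metis
  have "(2::rat) ^ Y x = 2 ^ Y y" using assms(2) x y by (simp add: weight_def)
  then have "Y x = Y y" by simp
  then show False using assms x y by (auto dest: inj_onD)
qed

text \<open>Injectivity makes the exponents distinct, so a finite sum of weights is a finite part of
  the geometric series with sum \<open>2\<close>.\<close>

lemma sums_bounded_weight:
  assumes "inj_on Y A"
  shows "sums_bounded D (\<lambda>x. real_of_rat (weight A Y x)) 2"
  unfolding sums_bounded_def
proof (intro conjI ballI allI impI)
  show "0 \<le> real_of_rat (weight A Y x)" for x by (rule weight_bounds)
  fix S assume S: "finite S \<and> S \<subseteq> D"
  have "(\<Sum>x\<in>S. real_of_rat (weight A Y x)) = (\<Sum>x\<in>S \<inter> A. (1 / 2) ^ Y x)"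
    using S by (simp add: of_rat_weight sum.inter_restrict)
  also have "\<dots> = (\<Sum>n\<in>Y ` (S \<inter> A). (1 / 2) ^ n)"
    using inj_on_subset[OF assms, of "S \<inter> A"] by (simp add: sum.reindex)
  also have "\<dots> \<le> (\<Sum>n. (1 / 2) ^ n)"
    using S by (intro sum_le_suminf) (auto intro: summable_geometric)
  also have "\<dots> = 2" by (simp add: suminf_geometric)
  finally show "(\<Sum>x\<in>S. real_of_rat (weight A Y x)) \<le> 2" .
qed

text \<open>At a point of \<open>A\<close> the weight is positive, and continuity would keep it
  nonzero on a nonempty open interval; this interval would lie in the countable set
  \<open>A\<close>.\<close>

lemma weight_continuous_imp_notin:
  assumes "inj_on Y A" "x \<in> {0..1}" and cont: "continuous (at x within {0..1}) (\<lambda>x. real_of_rat (weight A Y x))"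
  shows "x \<notin> A"
proof
  assume "x \<in> A"
  then have "0 < real_of_rat (weight A Y x)" by (simp add: of_rat_weight)
  then obtain d where d: "d > 0"
    "\<And>y. y \<in> {0..1} \<Longrightarrow> dist y x < d \<Longrightarrow>
       dist (real_of_rat (weight A Y y)) (real_of_rat (weight A Y x)) < real_of_rat (weight A Y x)"
    using cont unfolding continuous_within_eps_delta by blast
  \<comment> \<open>Cutting the neighbourhood to the unit interval leaves a nonempty open interval
    even if \<open>x\<close> is an endpoint, where it becomes one-sided.\<close>
  define l u where "l = max 0 (x - d)" and "u = min 1 (x + d)"
  have "l < u" using assms(2) d(1) by (auto simp: l_def u_def)
  moreover have "{l<..<u} \<subseteq> A"
  proof
    fix y assume y: "y \<in> {l<..<u}"
    then have "dist (real_of_rat (weight A Y y)) (real_of_rat (weight A Y x)) < real_of_rat (weight A Y x)"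
      by (intro d(2)) (auto simp: l_def u_def dist_real_def)
    then have "real_of_rat (weight A Y y) \<noteq> 0"
      unfolding dist_real_def by linarith
    then show "y \<in> A" by (auto simp: of_rat_weight split: if_splits)
  qed
  moreover have "countable A" using assms(1) by (rule countableI')
  ultimately show False using uncountable_open_interval countable_subset by blast
qed

text \<open>On the half-line the map is \<open>x / (1 + x)\<close>. Injectivity carries the bound on
  finite sums over to the folded weight.\<close>

lemma inj_on_squash: "inj_on squash {0 :: real..}"
  by (rule inj_onI) (simp add: squash_def field_simps)

lemma squash_in_unit: "squash (x :: real) \<in> {0..1}"
  by (simp add: squash_def)

section \<open>Cantor realisers from the tasks\<close>

text \<open>The map \<open>c\<close> acts termwise on names: it is the identity on the unit interval
  and \<open>squash_code\<close> for functions on the line.\<close>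

definition weight_fnl ::
  "(nat \<Rightarrow> nat) \<Rightarrow> ((nat \<Rightarrow> nat) \<Rightarrow> nat) \<Rightarrow> ((nat \<Rightarrow> nat) \<Rightarrow> nat) \<Rightarrow> (nat \<Rightarrow> nat) \<Rightarrow> nat" where
  "weight_fnl c F\<^sub>A F\<^sub>Y \<alpha> = weight_code (F\<^sub>A (\<lambda>n. c (\<alpha> n))) (F\<^sub>Y (\<lambda>n. c (\<alpha> n)))"

lemma weight_fnl_eq:
  assumes "names (\<lambda>n. c (\<alpha> n)) x" "x \<in> {0..1}"
    and "represents_set {0..1} F\<^sub>A A" "represents_nat {0..1} F\<^sub>Y Y"
  shows "weight_fnl c F\<^sub>A F\<^sub>Y \<alpha> = rat_code (weight A Y x)"
proof -
  have "F\<^sub>A (\<lambda>n. c (\<alpha> n)) = (if x \<in> A then 1 else 0)" "F\<^sub>Y (\<lambda>n. c (\<alpha> n)) = Y x"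
    using assms unfolding represents_set_def represents_nat_def by blast+
  then show ?thesis
    by (simp add: weight_fnl_def weight_code_def weight_def rat_code_0 rat_code_inverse_power2)
qed

lemma uniformly_computable_apply_termwise:
  assumes "computable1 c"
  shows "uniformly_computable (\<lambda>p. [Low (Fnl (fst p)), Low (Fun (snd p))]) (\<lambda>p. fst p (\<lambda>n. c (snd p n)))"
proof (rule uniformly_computable_apply)
  have "uniformly_computable (\<lambda>p. [Low (Fun (snd (snd p))), Low (Num (fst p))]) (\<lambda>p. snd (snd p) (fst p))"
    using uniformly_computable_reparam[OF uniformly_computable_S7, of "\<lambda>p. (snd (snd p), fst p)"] by simp
  \<comment> \<open>S7 wants the function before its argument; in this list they stand at positions
    \<open>2\<close> and \<open>0\<close>.\<close>
  then have "uniformly_computable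
      (\<lambda>p. [Low (Num (fst p)), Low (Fnl (fst (snd p))), Low (Fun (snd (snd p)))]) (\<lambda>p. snd (snd p) (fst p))"
    by (rule uniformly_computable_select[where q = "[2, 0]" and k = 3]) auto
  from uniformly_computable_comp1[OF assms this]
  show "uniformly_computable (\<lambda>(n, p). [Low (Num n), Low (Fnl (fst p)), Low (Fun (snd p))])
      (\<lambda>(n, p). c (snd p n))"
    by (simp add: case_prod_unfold)
qed

text \<open>The positions are left open because type-two and operator arguments of the oracle put
  prefixes of different lengths before the two inputs.\<close>

lemma uniformly_computable_weight_fnl:
  assumes "computable1 c" "\<And>p. length (A p) = k" "i < k" "j < k" "l < k" "i \<noteq> l" "j \<noteq> l"
    and "\<And>p. A p ! i = Low (Fnl (F p))" "\<And>p. A p ! j = Low (Fnl (G p))" "\<And>p. A p ! l = Low (Fun (\<alpha> p))"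
  shows "uniformly_computable A (\<lambda>p. weight_fnl c (F p) (G p) (\<alpha> p))"
proof -
  have H: "uniformly_computable A (\<lambda>p. H p (\<lambda>n. c (\<alpha> p n)))"
    if H: "i < k" "i \<noteq> l" "\<And>p. A p ! i = Low (Fnl (H p))" for i H
  proof (rule uniformly_computable_select)
    show "uniformly_computable (\<lambda>p. [Low (Fnl (H p)), Low (Fun (\<alpha> p))]) (\<lambda>p. H p (\<lambda>n. c (\<alpha> p n)))"
      using uniformly_computable_reparam[OF uniformly_computable_apply_termwise[OF assms(1)],
          of "\<lambda>p. (H p, \<alpha> p)"] by simp
    show "distinct [i, l]" "set [i, l] \<subseteq> {..<k}" using H(1,2) assms(5) by simp_all
    show "map ((!) (A p)) [i, l] = [Low (Fnl (H p)), Low (Fun (\<alpha> p))]" for p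
      by (simp add: H(3) assms(10))
  qed (rule assms(2))
  show ?thesis
    unfolding weight_fnl_def
    by (rule uniformly_computable_comp2[OF computable2_weight_code H[OF assms(3,6,8)] H[OF assms(4,7,9)]])
qed

section \<open>From an index to a Cantor realiser\<close>

abbreviation cantor_args :: "obj \<Rightarrow> ((nat \<Rightarrow> nat) \<Rightarrow> nat) \<times> ((nat \<Rightarrow> nat) \<Rightarrow> nat) \<times> nat \<Rightarrow> obj list" where
  "cantor_args \<Phi> p \<equiv>
     [Low (Fnl (fst p)), Low (Fnl (fst (snd p))), Low (Num (snd (snd p))), \<Phi>, Low (Fnl exists2)]"

lemma cantor_oracle_call:
  assumes "\<forall>x \<in> set xs. uniformly_denoted (\<lambda>p.
      [\<Phi>, Low (Fnl (fst p)), Low (Fnl (fst (snd p))), Low (Num (snd (snd p))), Low (Fnl exists2)]) x"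
  shows "\<exists>e. \<forall>p m. obj_app \<Phi> (map (\<lambda>x. x p) xs) = Some m \<longrightarrow> kleene e (cantor_args \<Phi> p) m"
  by (rule oracle_call[where A = "cantor_args \<Phi>" and k = 5 and q = "[3, 0, 1, 2, 4]", OF _ _ _ _ assms])
     auto

text \<open>It suffices to find one index, uniform in both inputs and the precision
  \<open>n\<close>, that computes the terms of a name of a point outside \<open>A\<close>.\<close>

lemma cantor_realiserI:
  assumes "\<And>F\<^sub>A F\<^sub>Y A Y. represents_set {0..1} F\<^sub>A A \<Longrightarrow> represents_nat {0..1} F\<^sub>Y Y \<Longrightarrow> inj_on Y A \<Longrightarrow>
      \<exists>x \<in> {0..1} - A. \<exists>\<alpha>. names \<alpha> x \<and> (\<forall>n. kleene e (cantor_args (Fnl3 \<tau> T) (F\<^sub>A, F\<^sub>Y, n)) (\<alpha> n))"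
  shows "computes_with_exists2 \<tau> T sig_cantor cantor_realiser"
proof -
  obtain C where C: "kleene_computable_from sig_cantor C [Fnl3 \<tau> T, Low (Fnl exists2)]"
    "\<And>xs m. map ty_of xs = sig_cantor \<Longrightarrow> kleene e (map Low xs @ [Fnl3 \<tau> T, Low (Fnl exists2)]) m \<Longrightarrow>
       C xs = Some m"
    using kleene_computable_from_index by blast
  have "cantor_realiser C"
    unfolding cantor_realiser_def
  proof (intro allI impI)
    fix F\<^sub>A F\<^sub>Y A and Y :: "real \<Rightarrow> nat"
    assume "A \<subseteq> {0..1} \<and> represents_set {0..1} F\<^sub>A A \<and> represents_nat {0..1} F\<^sub>Y Y \<and> inj_on Y A"
    then obtain x \<alpha> where x: "x \<in> {0..1} - A" "names \<alpha> x"
      "\<And>n. kleene e (cantor_args (Fnl3 \<tau> T) (F\<^sub>A, F\<^sub>Y, n)) (\<alpha> n)"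
      using assms by blast
    then have "C ([Fnl F\<^sub>A, Fnl F\<^sub>Y] @ [Num n]) = Some (\<alpha> n)" for n
      by (intro C(2)) simp_all
    with x show "\<exists>x \<in> {0..1} - A. outputs_real C [Fnl F\<^sub>A, Fnl F\<^sub>Y] x"
      unfolding outputs_real_def by blast
  qed
  with C(1) show ?thesis unfolding computes_with_exists2_def by blast
qed

section \<open>Tasks on the unit interval\<close>

text \<open>Equal weights at distinct points force the first point out of \<open>A\<close>, so the
  selector is fixed to \<open>Num 0\<close>. Leaving \<open>V\<close> abstract treats both notions
  of variation at once.\<close>

lemma task1_computes_cantor_realiser:
  assumes V: "\<And>h B. sums_bounded {0..1} h B \<Longrightarrow> V 0 1 h" and T: "task1 V T"
  shows "computes_with_exists2 sig_pair T sig_cantor cantor_realiser"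
proof -
  let ?\<Phi> = "Fnl3 sig_pair T"
  let ?B = "\<lambda>p. [?\<Phi>, Low (Fnl (fst p)), Low (Fnl (fst (snd p))), Low (Num (snd (snd p))), Low (Fnl exists2)]"
  have "uniformly_denoted ?B (\<lambda>p. Fnl (weight_fnl (\<lambda>n. n) (fst p) (fst (snd p))))"
    by (rule uniformly_denoted_Fnl, unfold case_prod_unfold,
        rule uniformly_computable_weight_fnl[OF computable1_id, where k = 6 and i = 2 and j = 3 and l = 0]) auto
  moreover have "uniformly_denoted ?B (\<lambda>p. Num 0)"
    by (rule uniformly_denoted_Num, rule uniformly_computable_const) auto
  moreover have "uniformly_denoted ?B (\<lambda>p. Num (snd (snd p)))"
    by (rule uniformly_denoted_Num, rule uniformly_computable_var[where k = 5 and i = 3]) auto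
  ultimately have den: "\<forall>x \<in> set [\<lambda>p. Fnl (weight_fnl (\<lambda>n. n) (fst p) (fst (snd p))), \<lambda>p. Num 0,
        \<lambda>p. Num (snd (snd p))]. uniformly_denoted ?B x" by simp
  obtain e where e: "\<And>p m. obj_app ?\<Phi> (map (\<lambda>x. x p)
        [\<lambda>p. Fnl (weight_fnl (\<lambda>n. n) (fst p) (fst (snd p))), \<lambda>p. Num 0, \<lambda>p. Num (snd (snd p))]) = Some m \<Longrightarrow>
      kleene e (cantor_args ?\<Phi> p) m"
    using cantor_oracle_call[OF den] by blast
  show ?thesis
  proof (rule cantor_realiserI)
    fix F\<^sub>A F\<^sub>Y A Y
    assume A: "represents_set {0..1} F\<^sub>A A" and Y: "represents_nat {0..1} F\<^sub>Y Y" and inj: "inj_on Y A"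
    let ?F = "weight_fnl (\<lambda>n. n) F\<^sub>A F\<^sub>Y"
    have "represents_rat {0..1} ?F (weight A Y)"
      unfolding represents_rat_def represents_nat_def using A Y by (auto intro!: weight_fnl_eq)
    moreover have "V 0 1 (\<lambda>x. real_of_rat (weight A Y x))" using V sums_bounded_weight[OF inj] by blast
    ultimately obtain x y where x: "x \<in> {0..1}" "x \<noteq> y" "weight A Y x = weight A Y y"
      "outputs_real_pair T [Fnl ?F] x y"
      using T unfolding task1_def by blast
    then obtain \<alpha> where "names \<alpha> x" "\<And>n. T [Fnl ?F, Num 0, Num n] = Some (\<alpha> n)"
      unfolding outputs_real_pair_def outputs_real_def by auto
    moreover from this(2) have "kleene e (cantor_args ?\<Phi> (F\<^sub>A, F\<^sub>Y, n)) (\<alpha> n)" for n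
      by (intro e) simp
    moreover have "x \<notin> A" using weight_eq_imp_notin[OF inj x(3,2)] .
    ultimately show "\<exists>x \<in> {0..1} - A. \<exists>\<alpha>. names \<alpha> x \<and> (\<forall>n. kleene e (cantor_args ?\<Phi> (F\<^sub>A, F\<^sub>Y, n)) (\<alpha> n))"
      using x(1) by blast
  qed
qed

text \<open>The operator ignores the precision \<open>j\<close>: the weight is rational, and a
  constant sequence of its code is a name of it.\<close>

lemma real_oracle_call:
  obtains e where "\<And>F\<^sub>A F\<^sub>Y n m. T [Op (\<lambda>\<alpha> j. weight_fnl (\<lambda>n. n) F\<^sub>A F\<^sub>Y \<alpha>), Num n] = Some m \<Longrightarrow>
      kleene e (cantor_args (Fnl3 sig_real T) (F\<^sub>A, F\<^sub>Y, n)) m"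
proof -
  let ?\<Phi> = "Fnl3 sig_real T"
  let ?B = "\<lambda>p. [?\<Phi>, Low (Fnl (fst p)), Low (Fnl (fst (snd p))), Low (Num (snd (snd p))), Low (Fnl exists2)]"
  have "uniformly_denoted ?B (\<lambda>p. Op (\<lambda>\<alpha> j. weight_fnl (\<lambda>n. n) (fst p) (fst (snd p)) \<alpha>))"
    by (rule uniformly_denoted_Op, unfold case_prod_unfold,
        rule uniformly_computable_weight_fnl[OF computable1_id, where k = 7 and i = 3 and j = 4 and l = 0]) auto
  moreover have "uniformly_denoted ?B (\<lambda>p. Num (snd (snd p)))"
    by (rule uniformly_denoted_Num, rule uniformly_computable_var[where k = 5 and i = 3]) auto
  ultimately have den: "\<forall>x \<in> set [\<lambda>p. Op (\<lambda>\<alpha> j. weight_fnl (\<lambda>n. n) (fst p) (fst (snd p)) \<alpha>),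
        \<lambda>p. Num (snd (snd p))]. uniformly_denoted ?B x" by simp
  obtain e where e: "\<And>p m. obj_app ?\<Phi> (map (\<lambda>x. x p)
        [\<lambda>p. Op (\<lambda>\<alpha> j. weight_fnl (\<lambda>n. n) (fst p) (fst (snd p)) \<alpha>), \<lambda>p. Num (snd (snd p))]) = Some m \<Longrightarrow>
      kleene e (cantor_args ?\<Phi> p) m"
    using cantor_oracle_call[OF den] by blast
  have "kleene e (cantor_args ?\<Phi> (F\<^sub>A, F\<^sub>Y, n)) m"
    if "T [Op (\<lambda>\<alpha> j. weight_fnl (\<lambda>n. n) F\<^sub>A F\<^sub>Y \<alpha>), Num n] = Some m" for F\<^sub>A F\<^sub>Y n m
    by (rule e) (simp add: that)
  then show thesis by (rule that)
qed

lemma real_oracle_computes_cantor_realiser: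
  assumes T: "\<And>F A Y. inj_on Y A \<Longrightarrow> represents_real {0..1} F (\<lambda>x. real_of_rat (weight A Y x)) \<Longrightarrow>
      \<exists>x \<in> {0..1} - A. outputs_real T [Op F] x"
  shows "computes_with_exists2 sig_real T sig_cantor cantor_realiser"
proof -
  obtain e where e: "\<And>F\<^sub>A F\<^sub>Y n m. T [Op (\<lambda>\<alpha> j. weight_fnl (\<lambda>n. n) F\<^sub>A F\<^sub>Y \<alpha>), Num n] = Some m \<Longrightarrow>
      kleene e (cantor_args (Fnl3 sig_real T) (F\<^sub>A, F\<^sub>Y, n)) m"
    using real_oracle_call by blast
  show ?thesis
  proof (rule cantor_realiserI)
    fix F\<^sub>A F\<^sub>Y A Y
    assume A: "represents_set {0..1} F\<^sub>A A" and Y: "represents_nat {0..1} F\<^sub>Y Y" and inj: "inj_on Y A"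
    let ?F = "\<lambda>\<alpha> j :: nat. weight_fnl (\<lambda>n. n) F\<^sub>A F\<^sub>Y \<alpha>"
    have "represents_real {0..1} ?F (\<lambda>x. real_of_rat (weight A Y x))"
      unfolding represents_real_def
    proof (intro allI impI)
      fix \<alpha> x assume "names \<alpha> x \<and> x \<in> {0..1}"
      then have "weight_fnl (\<lambda>n. n) F\<^sub>A F\<^sub>Y \<alpha> = rat_code (weight A Y x)"
        using A Y by (intro weight_fnl_eq) auto
      then show "names (?F \<alpha>) (real_of_rat (weight A Y x))" using names_of_rat by simp
    qed
    then obtain x where x: "x \<in> {0..1} - A" "outputs_real T [Op ?F] x" using T[OF inj] by blast
    then obtain \<alpha> where "names \<alpha> x" "\<And>n. T [Op ?F, Num n] = Some (\<alpha> n)"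
      unfolding outputs_real_def by auto
    then show "\<exists>x \<in> {0..1} - A. \<exists>\<alpha>. names \<alpha> x \<and>
        (\<forall>n. kleene e (cantor_args (Fnl3 sig_real T) (F\<^sub>A, F\<^sub>Y, n)) (\<alpha> n))"
      using x(1) e by blast
  qed
qed

lemma task2_computes_cantor_realiser:
  assumes V: "\<And>h B. sums_bounded {0..1} h B \<Longrightarrow> V 0 1 h" and T: "task2 V T"
  shows "computes_with_exists2 sig_real T sig_cantor cantor_realiser"
proof (rule real_oracle_computes_cantor_realiser)
  fix F A and Y :: "real \<Rightarrow> nat"
  assume inj: "inj_on Y A" and F: "represents_real {0..1} F (\<lambda>x. real_of_rat (weight A Y x))"
  have "V 0 1 (\<lambda>x. real_of_rat (weight A Y x))" using V sums_bounded_weight[OF inj] by blast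
  then obtain x where "x \<in> {0..1}" "continuous (at x within {0..1}) (\<lambda>x. real_of_rat (weight A Y x))"
    "outputs_real T [Op F] x"
    using T F unfolding task2_def by blast
  then show "\<exists>x \<in> {0..1} - A. outputs_real T [Op F] x"
    using weight_continuous_imp_notin[OF inj] by blast
qed

lemma task3_computes_cantor_realiser:
  assumes V: "\<And>h B. sums_bounded {0..1} h B \<Longrightarrow> V 0 1 h" and T: "task3 V T"
  shows "computes_with_exists2 sig_real T sig_cantor cantor_realiser"
proof (rule real_oracle_computes_cantor_realiser)
  fix F A and Y :: "real \<Rightarrow> nat"
  assume inj: "inj_on Y A" and F: "represents_real {0..1} F (\<lambda>x. real_of_rat (weight A Y x))"
  have "V 0 1 (\<lambda>x. real_of_rat (weight A Y x))" using V sums_bounded_weight[OF inj] by blast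
  moreover have "has_riemann_integral (\<lambda>x. real_of_rat (weight A Y x)) 0 1 0"
    by (rule has_riemann_integral_sums_bounded[OF sums_bounded_weight[OF inj]])
  moreover have "(\<lambda>x. real_of_rat (weight A Y x)) ` {0..1} \<subseteq> {0..1}"
    using weight_bounds by auto
  ultimately obtain x where "x \<in> {0..1}" "real_of_rat (weight A Y x) = 0" "outputs_real T [Op F] x"
    using T F unfolding task3_def by blast
  then show "\<exists>x \<in> {0..1} - A. outputs_real T [Op F] x"
    by (auto simp: weight_eq_0_iff)
qed

section \<open>Laplace transforms on the folded line\<close>

lemma task4_computes_cantor_realiser:
  assumes V: "\<And>h a B. 0 < a \<Longrightarrow> sums_bounded {0..a} h B \<Longrightarrow> V 0 a h" and T: "task4 V T"
  shows "computes_with_exists2 sig_real2 T sig_cantor cantor_realiser"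
proof -
  let ?\<Phi> = "Fnl3 sig_real2 T"
  \<comment> \<open>The number \<open>1\<close> is the code of the rational \<open>0\<close>, so
    this operator represents the zero function.\<close>
  let ?G = "\<lambda>(\<alpha> :: nat \<Rightarrow> nat) (j :: nat). 1 :: nat"
  let ?B = "\<lambda>p. [?\<Phi>, Low (Fnl (fst p)), Low (Fnl (fst (snd p))), Low (Num (snd (snd p))), Low (Fnl exists2)]"
  have "uniformly_denoted ?B (\<lambda>p. Op (\<lambda>\<alpha> j. weight_fnl squash_code (fst p) (fst (snd p)) \<alpha>))"
    by (rule uniformly_denoted_Op, unfold case_prod_unfold,
        rule uniformly_computable_weight_fnl[OF computable1_squash_code, where k = 7 and i = 3 and j = 4 and l = 0])
       auto
  moreover have "uniformly_denoted ?B (\<lambda>p. Op ?G)"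
    by (rule uniformly_denoted_Op, unfold case_prod_unfold, rule uniformly_computable_const[where k = 7]) auto
  moreover have "uniformly_denoted ?B (\<lambda>p. Num (snd (snd p)))"
    by (rule uniformly_denoted_Num, rule uniformly_computable_var[where k = 5 and i = 3]) auto
  ultimately have den: "\<forall>x \<in> set [\<lambda>p. Op (\<lambda>\<alpha> j. weight_fnl squash_code (fst p) (fst (snd p)) \<alpha>),
        \<lambda>p. Op ?G, \<lambda>p. Num (snd (snd p))]. uniformly_denoted ?B x" by simp
  obtain e where e: "\<And>p m. obj_app ?\<Phi> (map (\<lambda>x. x p)
        [\<lambda>p. Op (\<lambda>\<alpha> j. weight_fnl squash_code (fst p) (fst (snd p)) \<alpha>), \<lambda>p. Op ?G,
         \<lambda>p. Num (snd (snd p))]) = Some m \<Longrightarrow>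
      kleene e (cantor_args ?\<Phi> p) m"
    using cantor_oracle_call[OF den] by blast
  \<comment> \<open>The oracle answers with a name of a point of the line; composing with
    \<open>squash_code\<close> by S4 turns it into a name of the folded point.\<close>
  have "uniformly_computable (\<lambda>(m, p). Low (Num m) # cantor_args ?\<Phi> p) (\<lambda>(m, p). squash_code m)"
    using uniformly_computable_append[OF uniformly_computable_reparam[OF computable1_squash_code, of fst],
        of "\<lambda>(m, p). cantor_args ?\<Phi> p" 5]
    by (simp add: case_prod_unfold)
  then have "\<exists>e'. \<forall>m p. kleene e' (Low (Num m) # cantor_args ?\<Phi> p) (squash_code m)"
    unfolding uniformly_computable_def by auto
  then obtain e' where e': "\<And>m p. kleene e' (Low (Num m) # cantor_args ?\<Phi> p) (squash_code m)"
    by blast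
  show ?thesis
  proof (rule cantor_realiserI)
    fix F\<^sub>A F\<^sub>Y A Y
    assume A: "represents_set {0..1} F\<^sub>A A" and Y: "represents_nat {0..1} F\<^sub>Y Y" and inj: "inj_on Y A"
    let ?F = "\<lambda>\<alpha> j :: nat. weight_fnl squash_code F\<^sub>A F\<^sub>Y \<alpha>"
    let ?f = "\<lambda>x. real_of_rat (weight A Y (squash x))"
    have "represents_real UNIV ?F ?f"
      unfolding represents_real_def
    proof (intro allI impI)
      fix \<alpha> and x :: real assume "names \<alpha> x \<and> x \<in> UNIV"
      then have "weight_fnl squash_code F\<^sub>A F\<^sub>Y \<alpha> = rat_code (weight A Y (squash x))"
        using weight_fnl_eq[where c = squash_code, OF _ squash_in_unit A Y] names_squash by blast
      then show "names (?F \<alpha>) (?f x)" using names_of_rat by simp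
    qed
    moreover have "represents_real UNIV ?G (\<lambda>_. 0)"
      using names_of_rat[of 0] by (simp add: represents_real_def rat_code_0)
    moreover have sf: "sums_bounded {0..} ?f 2"
      by (rule sums_bounded_compose[OF sums_bounded_weight[OF inj, of UNIV] inj_on_squash]) simp
    have "V 0 a ?f \<and> V 0 a (\<lambda>_. 0)" if "a > 0" for a
      using V[OF that sums_bounded_subset[OF sf]] V[OF that sums_bounded_zero] by simp
    moreover have "\<forall>s\<ge>0. \<exists>L. has_laplace_transform ?f s L \<and> has_laplace_transform (\<lambda>_. 0) s L"
      using has_laplace_transform_sums_bounded[OF sf]
        has_laplace_transform_sums_bounded[OF sums_bounded_zero] by blast
    ultimately obtain x where x: "?f x = 0" "outputs_real T [Op ?F, Op ?G] x"
      using T unfolding task4_def by blast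
    then obtain \<alpha> where \<alpha>: "names \<alpha> x" "\<And>n. T [Op ?F, Op ?G, Num n] = Some (\<alpha> n)"
      unfolding outputs_real_def by auto
    from \<alpha>(2) have "kleene e (cantor_args ?\<Phi> (F\<^sub>A, F\<^sub>Y, n)) (\<alpha> n)" for n
      by (intro e) simp
    then have "kleene (list_encode [4, e', e]) (cantor_args ?\<Phi> (F\<^sub>A, F\<^sub>Y, n)) (squash_code (\<alpha> n))" for n
      by (rule S4[OF _ e'])
    moreover have "squash x \<in> {0..1} - A"
      using x(1) squash_in_unit[of x] by (simp add: weight_eq_0_iff)
    ultimately show "\<exists>x \<in> {0..1} - A. \<exists>\<alpha>. names \<alpha> x \<and>
        (\<forall>n. kleene (list_encode [4, e', e]) (cantor_args ?\<Phi> (F\<^sub>A, F\<^sub>Y, n)) (\<alpha> n))"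
      using names_squash[OF \<alpha>(1)] by blast
  qed
qed

section \<open>NIN-realisers\<close>

text \<open>A representation of a rational-valued \<open>f\<close> is already one of the
  number-valued map \<open>x \<mapsto> rat_code (f x)\<close>. Calling \<open>N\<close> on it gives
  a collision of codes, hence of values.\<close>

lemma nin_realiser_computes_task1:
  assumes N: "nin_realiser N"
  shows "\<exists>T. task1 V T \<and> kleene_computable_from sig_pair T [Fnl3 sig_pair N]"
proof -
  let ?\<Phi> = "Fnl3 sig_pair N"
  let ?A = "\<lambda>p. [Low (Fnl (fst p)), Low (Num (fst (snd p))), Low (Num (snd (snd p))), ?\<Phi>]"
  let ?B = "\<lambda>p. [?\<Phi>, Low (Fnl (fst p)), Low (Num (fst (snd p))), Low (Num (snd (snd p)))]"
  \<comment> \<open>S8 receives its arguments through indices, so the input has to be presented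
    again as the map taking \<open>\<alpha>\<close> to its value at \<open>\<alpha>\<close>.\<close>
  have "uniformly_computable (\<lambda>(\<alpha>, p). Low (Fun \<alpha>) # ?B p) (\<lambda>(\<alpha>, p). fst p \<alpha>)"
    unfolding case_prod_unfold
    by (rule uniformly_computable_select[where q = "[2, 0]" and k = 5,
          OF uniformly_computable_reparam[OF uniformly_computable_apply_termwise[OF computable1_id],
            of "\<lambda>p. (fst (snd p), fst p)", simplified]]) auto
  then have "uniformly_denoted ?B (\<lambda>p. Fnl (fst p))" by (rule uniformly_denoted_Fnl)
  moreover have "uniformly_denoted ?B (\<lambda>p. Num (fst (snd p)))"
    by (rule uniformly_denoted_Num, rule uniformly_computable_var[where k = 4 and i = 2]) auto
  moreover have "uniformly_denoted ?B (\<lambda>p. Num (snd (snd p)))"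
    by (rule uniformly_denoted_Num, rule uniformly_computable_var[where k = 4 and i = 3]) auto
  ultimately have den: "\<forall>x \<in> set [\<lambda>p. Fnl (fst p), \<lambda>p. Num (fst (snd p)), \<lambda>p. Num (snd (snd p))].
      uniformly_denoted ?B x" by simp
  have "\<exists>e. \<forall>p m. obj_app ?\<Phi> (map (\<lambda>x. x p)
      [\<lambda>p. Fnl (fst p), \<lambda>p. Num (fst (snd p)), \<lambda>p. Num (snd (snd p))]) = Some m \<longrightarrow> kleene e (?A p) m"
    by (rule oracle_call[where k = 4 and q = "[3, 0, 1, 2]", OF _ _ _ _ den]) auto
  then obtain e where e: "\<And>p m. obj_app ?\<Phi> (map (\<lambda>x. x p)
      [\<lambda>p. Fnl (fst p), \<lambda>p. Num (fst (snd p)), \<lambda>p. Num (snd (snd p))]) = Some m \<Longrightarrow> kleene e (?A p) m"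
    by blast
  obtain T where T: "kleene_computable_from sig_pair T [?\<Phi>]"
    "\<And>xs m. map ty_of xs = sig_pair \<Longrightarrow> kleene e (map Low xs @ [?\<Phi>]) m \<Longrightarrow> T xs = Some m"
    using kleene_computable_from_index by blast
  have "T [Fnl F, Num i, Num n] = Some m" if "N [Fnl F, Num i, Num n] = Some m" for F i n m
    using e[of "(F, i, n)" m] that by (intro T(2)) simp_all
  then have out: "outputs_real_pair T [Fnl F] x y" if "outputs_real_pair N [Fnl F] x y" for F x y
    using that unfolding outputs_real_pair_def outputs_real_def by fastforce
  have "task1 V T"
    unfolding task1_def
  proof (intro allI impI)
    fix F and f :: "real \<Rightarrow> rat"
    assume "represents_rat {0..1} F f \<and> V 0 1 (\<lambda>x. real_of_rat (f x))"
    then have "represents_nat {0..1} F (\<lambda>x. rat_code (f x))" unfolding represents_rat_def by blast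
    then obtain x y where "x \<in> {0..1}" "y \<in> {0..1}" "x \<noteq> y" "rat_code (f x) = rat_code (f y)"
      "outputs_real_pair N [Fnl F] x y"
      using N unfolding nin_realiser_def by blast
    then show "\<exists>x \<in> {0..1}. \<exists>y \<in> {0..1}. x \<noteq> y \<and> f x = f y \<and> outputs_real_pair T [Fnl F] x y"
      using out injD[OF inj_rat_code] by blast
  qed
  with T(1) show ?thesis by blast
qed

section \<open>Weak realisers and the combined statement\<close>

text \<open>A bijection is injective, so every input of a weak realiser is an input of a Cantor
  realiser.\<close>

lemma cantor_realiser_imp_weak: "cantor_realiser C \<Longrightarrow> weak_cantor_realiser C"
  unfolding cantor_realiser_def weak_cantor_realiser_def bij_betw_def by blast

lemma computes_weak_cantor_realiser:
  "computes_with_exists2 \<tau> T \<sigma> cantor_realiser \<Longrightarrow> computes_with_exists2 \<tau> T \<sigma> weak_cantor_realiser"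
  unfolding computes_with_exists2_def using cantor_realiser_imp_weak by blast

lemma riemann_integrable_sums_bounded: "sums_bounded {a..b} h B \<Longrightarrow> riemann_integrable a b h"
  unfolding riemann_integrable_def using has_riemann_integral_sums_bounded by blast

theorem theorem3p12:
  shows "(\<forall>T.
      (task1 bounded_variation T \<longrightarrow> computes_with_exists2 sig_pair T sig_cantor cantor_realiser) \<and>
      (task2 bounded_variation T \<longrightarrow> computes_with_exists2 sig_real T sig_cantor cantor_realiser) \<and>
      (task3 riemann_integrable T \<longrightarrow> computes_with_exists2 sig_real T sig_cantor cantor_realiser) \<and>
      (task3 bounded_variation T \<longrightarrow> computes_with_exists2 sig_real T sig_cantor cantor_realiser) \<and>
      (task4 bounded_variation T \<longrightarrow> computes_with_exists2 sig_real2 T sig_cantor cantor_realiser)) \<and>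
    (\<forall>N. nin_realiser N \<longrightarrow>
      (\<exists>T. task1 bounded_variation T \<and> kleene_computable_from sig_pair T [Fnl3 sig_pair N])) \<and>
    (\<forall>T.
      (task1 has_variation T \<longrightarrow> computes_with_exists2 sig_pair T sig_cantor weak_cantor_realiser) \<and>
      (task2 has_variation T \<longrightarrow> computes_with_exists2 sig_real T sig_cantor weak_cantor_realiser) \<and>
      (task3 riemann_integrable T \<longrightarrow> computes_with_exists2 sig_real T sig_cantor weak_cantor_realiser) \<and>
      (task3 has_variation T \<longrightarrow> computes_with_exists2 sig_real T sig_cantor weak_cantor_realiser) \<and>
      (task4 has_variation T \<longrightarrow> computes_with_exists2 sig_real2 T sig_cantor weak_cantor_realiser))"
proof -
  \<comment> \<open>Positivity of \<open>a\<close> ensures that the set of variation sums is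
    nonempty.\<close>
  have hv: "has_variation 0 a h" if "sums_bounded {0..a} h B" "0 < a" for a h B
    using has_variation_sums_bounded that by (simp add: less_imp_le)
  note tasks = task1_computes_cantor_realiser[rotated] task2_computes_cantor_realiser[rotated]
    task3_computes_cantor_realiser[rotated] task4_computes_cantor_realiser[rotated]
  show ?thesis
    by (intro conjI allI impI nin_realiser_computes_task1 computes_weak_cantor_realiser;
        (assumption |
         (erule tasks, (erule bounded_variation_sums_bounded | erule riemann_integrable_sums_bounded |
            (erule hv, simp)))))
qed

end
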